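(* Let $1\le k\le |V_I|$, let $\lambda_k(\Delta_p)$ be the $k$-th variational eigenvalue of the $p$-Laplacian on $G$, and let $R_k$ be the $k$-th packing radius of $G$. Then $$\Lambda_k=\lim_{p\to\infty}\lambda_k(\Delta_p)^{1/p}\le\frac1{R_k}.$$
   Context: $G=(V,E,\omega)$ is a finite undirected weighted graph: $E\subset V\times V$ is symmetric and $\omega_{uv}=\omega_{vu}>0$ for $(u,v)\in E$; $u\sim v$ means $(u,v)\in E$. $B\subset V$ (possibly empty) is the boundary and $V_I=V\setminus B\neq\emptyset$ the set of internal nodes. $G$ is connected: if $B=\emptyset$ any two nodes are joined by a path; if $B\ne\emptyset$ the subgraph induced by $V_I$ is connected and at least one internal node is adjacent to $B$. $\mathcal H_0(V)=\{f:V\to\mathbb R:\ f=0 \text{ on } B\}$. The length of a path $v_0\sim v_1\sim\dots\sim v_n$ is $\sum_{i=1}^n\omega_{v_{i-1}v_i}^{-1}$; $d(u,v)$ is the minimal length of a path joining $u$ and $v$ (so $d(u,u)=0$), and $d_B(u)=\min_{v\in B}d(u,v)$, with $d_B\equiv+\infty$ if $B=\emptyset$. $k$-th packing radius: $R_k=\max\{r>0:\ \exists\,u_1,\dots,u_k\in V_I \text{ with } d(u_i,u_j)\ge 2r \text{ for all } i\neq j \text{ and } d_B(u_i)\ge r \text{ for all } i\}$ (if $B=\emptyset$ and $k=1$, then $R_1=+\infty$ and $1/R_1=0$). For $p\in(1,\infty)$ and $f\in\mathcal H_0(V)$: $\nabla f(u,v)=\omega_{uv}(f(v)-f(u))$,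 $\|\nabla f\|_p^p=\frac12\sum_{(u,v)\in E}|\nabla f(u,v)|^p$, $\|f\|_p^p=\sum_{u\in V}|f(u)|^p$, $\mathcal R_p(f)=\|\nabla f\|_p/\|f\|_p$ for $f\ne0$, $S_p=\{f\in\mathcal H_0(V):\|f\|_p=1\}$. The $k$-th variational eigenvalue of the $p$-Laplacian is $\lambda_k(\Delta_p)=\min_{A\in\mathcal F_k(S_p)}\max_{f\in A}\mathcal R_p(f)^p$, where $\mathcal F_k(S_p)$ is the family of closed symmetric ($A=-A$) subsets of $S_p$ with Krasnoselskii genus at least $k$. The genus of a closed symmetric set $A$ is $0$ if $A=\emptyset$, otherwise the least $h\in\mathbb N$ for which there is a continuous odd map $A\to\mathbb R^h\setminus\{0\}$ ($\infty$ if there is none). The limit $\Lambda_k:=\lim_{p\to\infty}\lambda_k(\Delta_p)^{1/p}$ exists. *)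

theory Defs
  imports "HOL-Analysis.Analysis"
begin

(* The vertex set V is the finite type 'v; a function V \<rightarrow> \<real> is a vector in real ^ 'v.
   Only the values of w on E are ever used. *)
locale weighted_graph_with_boundary =
  fixes E :: "('v::finite \<times> 'v) set"
    and w :: "'v \<Rightarrow> 'v \<Rightarrow> real"
    and B :: "'v set"
  assumes sym_edges: "sym E"
    and weight_sym: "\<And>u v. (u, v) \<in> E \<Longrightarrow> w u v = w v u"
    and weight_pos: "\<And>u v. (u, v) \<in> E \<Longrightarrow> w u v > 0"
    and internal_nonempty: "- B \<noteq> {}"
    and connected_no_boundary: "B = {} \<Longrightarrow> (u, v) \<in> E\<^sup>*"
    and connected_internal:
      "\<lbrakk>B \<noteq> {}; u \<in> - B; v \<in> - B\<rbrakk> \<Longrightarrow> (u, v) \<in> (E \<inter> (- B) \<times> (- B))\<^sup>*"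
    and boundary_adjacent: "B \<noteq> {} \<Longrightarrow> \<exists>u\<in>- B. \<exists>v\<in>B. (u, v) \<in> E"


subsection \<open>Distances and packing radii\<close>

definition path_between :: "('v \<times> 'v) set \<Rightarrow> 'v \<Rightarrow> 'v \<Rightarrow> 'v list \<Rightarrow> bool" where
  "path_between E u v vs \<longleftrightarrow>
     vs \<noteq> [] \<and> hd vs = u \<and> last vs = v \<and> successively (\<lambda>x y. (x, y) \<in> E) vs"

definition path_length :: "('v \<Rightarrow> 'v \<Rightarrow> real) \<Rightarrow> 'v list \<Rightarrow> real" where
  "path_length w vs = (\<Sum>i = 1..<length vs. inverse (w (vs ! (i - 1)) (vs ! i)))"

(* Paths may run through boundary nodes.  The infimum is a minimum when some path exists;
   it is \<infinity> when there is none (possible only if a boundary node is involved). *)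
definition graph_dist :: "('v \<times> 'v) set \<Rightarrow> ('v \<Rightarrow> 'v \<Rightarrow> real) \<Rightarrow> 'v \<Rightarrow> 'v \<Rightarrow> ereal" where
  "graph_dist E w u v = (INF vs\<in>{vs. path_between E u v vs}. ereal (path_length w vs))"

(* For B = {} the infimum is \<infinity>. *)
definition boundary_dist ::
    "('v \<times> 'v) set \<Rightarrow> ('v \<Rightarrow> 'v \<Rightarrow> real) \<Rightarrow> 'v set \<Rightarrow> 'v \<Rightarrow> ereal" where
  "boundary_dist E w B u = (INF v\<in>B. graph_dist E w u v)"

definition packing_set ::
    "('v \<times> 'v) set \<Rightarrow> ('v \<Rightarrow> 'v \<Rightarrow> real) \<Rightarrow> 'v set \<Rightarrow> nat \<Rightarrow> real set" where
  "packing_set E w B k =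
     {r. r > 0 \<and> (\<exists>u :: nat \<Rightarrow> 'v.
           (\<forall>i\<in>{1..k}. u i \<in> - B) \<and>
           (\<forall>i\<in>{1..k}. \<forall>j\<in>{1..k}. i \<noteq> j \<longrightarrow> ereal (2 * r) \<le> graph_dist E w (u i) (u j)) \<and>
           (\<forall>i\<in>{1..k}. ereal r \<le> boundary_dist E w B (u i)))}"

(* For 1 \<le> k \<le> |V - B| the set of admissible radii is non-empty and defined by non-strict
   inequalities, so the supremum is a maximum, except when B = {} and k = 1: then every r > 0
   is admissible and the supremum is \<infinity>, which is the convention R_1 = \<infinity>. *)
definition packing_radius ::
    "('v \<times> 'v) set \<Rightarrow> ('v \<Rightarrow> 'v \<Rightarrow> real) \<Rightarrow> 'v set \<Rightarrow> nat \<Rightarrow> ereal" where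
  "packing_radius E w B k = (SUP r\<in>packing_set E w B k. ereal r)"


subsection \<open>Variational eigenvalues of the p-Laplacian\<close>

definition H0 :: "'v::finite set \<Rightarrow> (real ^ 'v) set" where
  "H0 B = {f. \<forall>u\<in>B. f $ u = 0}"

definition gradient :: "('v \<Rightarrow> 'v \<Rightarrow> real) \<Rightarrow> real ^ 'v \<Rightarrow> 'v::finite \<Rightarrow> 'v \<Rightarrow> real" where
  "gradient w f u v = w u v * (f $ v - f $ u)"

definition gradient_pnorm ::
    "('v::finite \<times> 'v) set \<Rightarrow> ('v \<Rightarrow> 'v \<Rightarrow> real) \<Rightarrow> real \<Rightarrow> real ^ 'v \<Rightarrow> real" where
  "gradient_pnorm E w p f = (1/2 * (\<Sum>(u, v)\<in>E. \<bar>gradient w f u v\<bar> powr p)) powr (1/p)"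

definition vertex_pnorm :: "real \<Rightarrow> real ^ 'v::finite \<Rightarrow> real" where
  "vertex_pnorm p f = (\<Sum>u\<in>UNIV. \<bar>f $ u\<bar> powr p) powr (1/p)"

definition rayleigh ::
    "('v::finite \<times> 'v) set \<Rightarrow> ('v \<Rightarrow> 'v \<Rightarrow> real) \<Rightarrow> real \<Rightarrow> real ^ 'v \<Rightarrow> real" where
  "rayleigh E w p f = gradient_pnorm E w p f / vertex_pnorm p f"

definition psphere :: "'v::finite set \<Rightarrow> real \<Rightarrow> (real ^ 'v) set" where
  "psphere B p = {f \<in> H0 B. vertex_pnorm p f = 1}"

(* Euclidean_space h is \<real>^h, realised as the sequences vanishing from index h on.
   The infimum over the empty set in enat is \<infinity>. *)
definition genus :: "'a::real_normed_vector set \<Rightarrow> enat" where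
  "genus A =
     (if A = {} then 0
      else (INF h\<in>{h :: nat. \<exists>\<phi> :: 'a \<Rightarrow> nat \<Rightarrow> real.
              continuous_map (top_of_set A) (Euclidean_space h) \<phi> \<and>
              (\<forall>x\<in>A. \<phi> x \<noteq> (\<lambda>i. 0)) \<and>
              (\<forall>x\<in>A. \<phi> (- x) = (\<lambda>i. - \<phi> x i))}. enat h))"

definition genus_family :: "nat \<Rightarrow> 'a::real_normed_vector set \<Rightarrow> 'a set set" where
  "genus_family k S = {A. A \<subseteq> S \<and> closed A \<and> uminus ` A = A \<and> enat k \<le> genus A}"

(* For 1 \<le> k \<le> |V - B| the family is non-empty and its members are non-empty and compact,
   and both the infimum and the supremum are attained, so this is the usual min-max. *)
definition variational_eigenvalue ::
    "('v::finite \<times> 'v) set \<Rightarrow> ('v \<Rightarrow> 'v \<Rightarrow> real) \<Rightarrow> 'v set \<Rightarrow> nat \<Rightarrow> real \<Rightarrow> real" where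
  "variational_eigenvalue E w B k p =
     (INF A\<in>genus_family k (psphere B p). SUP f\<in>A. rayleigh E w p f powr p)"

definition limit_eigenvalue ::
    "('v::finite \<times> 'v) set \<Rightarrow> ('v \<Rightarrow> 'v \<Rightarrow> real) \<Rightarrow> 'v set \<Rightarrow> nat \<Rightarrow> real" where
  "limit_eigenvalue E w B k =
     Lim at_top (\<lambda>p. variational_eigenvalue E w B k p powr (1/p))"

end

theory Submission
  imports Defs
begin

text \<open>
  As \<open>p\<close> tends to infinity, the Rayleigh quotient \<open>rayleigh E w p\<close> approaches the quotient
  \<open>sup_rayleigh E w\<close> of the largest weighted edge difference by the largest absolute value. It does
  so uniformly up to a factor: the \<open>p\<close>-th powers of the two quotients differ by factors that depend only on the
  numbers of edges and of vertices, and the \<open>p\<close>-th roots of these constants tend to 1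
  (\<open>rayleigh_powr_bounds\<close>). Both quotients are homogeneous of degree 0, so the set on which the
  min-max is taken may be projected radially from any compact symmetric set that avoids 0
  (\<open>radial_projection\<close>). Hence \<open>variational_eigenvalue E w B k p powr (1/p)\<close> is squeezed between
  two multiples of one number that does not depend on \<open>p\<close>, the min-max value \<open>sup_eigenvalue\<close> of
  the limit quotient. So the limit exists and is this number (\<open>variational_eigenvalue_tendsto\<close>).

  To bound this number by \<open>1 / r\<close> for an admissible packing radius \<open>r\<close>, take for each of the \<open>k\<close>
  centres the tent function, which is \<open>r\<close> at the centre and decreases at unit speed with the
  distance. Because the centres are at distance at least \<open>2 r\<close> from each other and at least \<open>r\<close>
  from the boundary, the tents have disjoint supports and vanish on the boundary. A linear
  combination with coefficients of absolute value at most 1, at least one of them 1 or \<open>-1\<close>, has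
  a value of modulus at least \<open>r\<close>, and its gradient is at most 1 everywhere: also along an edge
  that joins the supports of two different tents, since the two values at its ends add up to at
  most its length (\<open>tent_combination_bounds\<close>). These combinations form a compact symmetric set,
  an odd image of the boundary of a \<open>k\<close>-dimensional cube.

  It remains to see that this boundary has genus at least \<open>k\<close> (\<open>genus_coord_sphere\<close>). This is the
  Borsuk-Ulam theorem, and it is proved here from Ky Fan's combinatorial lemma: if the vertices of
  a symmetric triangulation of the \<open>d\<close>-sphere carry nonzero integer labels, opposite at antipodes
  and never opposite at adjacent vertices, then an odd number of the \<open>d\<close>-simplices have labels
  that alternate in sign, beginning with a positive one, when they are ordered by absolute value.
  The triangulation used is the barycentric subdivision of the boundary of a cube that is cut into
  small cubes; its simplices are the complete flags of faces, and their incidences are easy to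
  count.
\<close>


section \<open>Alternating labels\<close>

text \<open>
  Ordered by absolute value, the labels are distinct and alternate in sign; the Boolean tells
  whether the smallest is positive. The position of a label in this order is the number of labels
  of smaller absolute value.
\<close>

definition alternating :: "bool \<Rightarrow> ('i \<Rightarrow> int) \<Rightarrow> 'i set \<Rightarrow> bool" where
  "alternating s l I \<longleftrightarrow> inj_on (\<lambda>r. \<bar>l r\<bar>) I \<and>
     (\<forall>r\<in>I. 0 < l r \<longleftrightarrow> even (card {q\<in>I. \<bar>l q\<bar> < \<bar>l r\<bar>}) = s)"

lemma alternating_cong:
  "(\<And>r. r \<in> I \<Longrightarrow> l r = m r) \<Longrightarrow> alternating s l I = alternating s m I"
proof -
  assume *: "\<And>r. r \<in> I \<Longrightarrow> l r = m r"
  have "inj_on (\<lambda>r. \<bar>l r\<bar>) I = inj_on (\<lambda>r. \<bar>m r\<bar>) I"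
    using * by (simp add: inj_on_def)
  moreover have "{q\<in>I. \<bar>l q\<bar> < \<bar>l r\<bar>} = {q\<in>I. \<bar>m q\<bar> < \<bar>m r\<bar>}" if "r \<in> I" for r
    using * that by auto
  ultimately show ?thesis using * by (simp add: alternating_def)
qed

lemma alternating_uminus:
  assumes "\<And>r. r \<in> I \<Longrightarrow> l r \<noteq> 0"
  shows "alternating s (\<lambda>r. - l r) I \<longleftrightarrow> alternating (\<not> s) l I"
proof -
  have "0 < - l r \<longleftrightarrow> \<not> 0 < l r" if "r \<in> I" for r using assms[OF that] by linarith
  then show ?thesis by (auto simp: alternating_def)
qed

lemma alternating_not_both:
  assumes "r \<in> I" shows "\<not> (alternating True l I \<and> alternating False l I)"
  using assms by (auto simp: alternating_def)

text \<open>
  A label of largest absolute value comes last, so it only has to have the sign of the last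
  position. This allows induction on the labels in the order of their absolute values.
\<close>

lemma alternating_insert_max:
  assumes "finite I" "t \<notin> I" "\<And>r. r \<in> I \<Longrightarrow> \<bar>l r\<bar> < \<bar>l t\<bar>"
  shows "alternating s l (insert t I) \<longleftrightarrow> alternating s l I \<and> (0 < l t \<longleftrightarrow> even (card I) = s)"
proof -
  have t: "{q \<in> insert t I. \<bar>l q\<bar> < \<bar>l t\<bar>} = I" using assms by auto
  have r: "{q \<in> insert t I. \<bar>l q\<bar> < \<bar>l r\<bar>} = {q \<in> I. \<bar>l q\<bar> < \<bar>l r\<bar>}" if "r \<in> I" for r
    using assms(3)[OF that] by auto
  have i: "inj_on (\<lambda>r. \<bar>l r\<bar>) (insert t I) \<longleftrightarrow> inj_on (\<lambda>r. \<bar>l r\<bar>) I"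
    using assms(3) by (fastforce simp: inj_on_insert)
  show ?thesis
    unfolding alternating_def i using t r by auto
qed

text \<open>
  The step of Ky Fan's parity argument for one simplex: only an alternating simplex, of either
  sign, has an odd number of facets that alternate starting with a positive label. By induction
  one removes a label of largest absolute value. If it occurs twice, the simplex is not alternating,
  and the only facets that can be are the two that omit one of its copies; they have the same
  labels. If it occurs once, its sign agrees either with the position it has in the simplex, and
  then omitting it is the only way to get such a facet, or with the position it has in the other
  facets, and then these facets correspond to those of the smaller simplex. For the empty simplex,
  which alternates in both senses and has no facets, both sides are false.
\<close>

lemma odd_alternating_facets_iff:
  assumes "finite I" "\<And>r q. r \<in> I \<Longrightarrow> q \<in> I \<Longrightarrow> l r \<noteq> - l q"
  shows "odd (card {r\<in>I. alternating True l (I - {r})}) \<longleftrightarrow>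
           alternating True l I \<noteq> alternating False l I"
  using assms
proof (induction I rule: finite_ranking_induct[where f = "\<lambda>r. \<bar>l r\<bar>"])
  case empty
  show ?case by (simp add: alternating_def)
next
  case (insert t I)
  let ?J = "insert t I"
  show ?case
  proof (cases "t \<in> I")
    case True
    then show ?thesis using insert by (simp add: insert_absorb)
  next
    case tI: False
    show ?thesis
    proof (cases "\<exists>y\<in>I. \<bar>l y\<bar> = \<bar>l t\<bar>")
      case True
      then obtain y where y: "y \<in> I" "\<bar>l y\<bar> = \<bar>l t\<bar>" by blast
      have ly: "l y = l t" using y insert.prems[of t y] by auto
      have ty: "t \<noteq> y" using y tI by auto
      have no_tie: "\<not> alternating s l K" if "a \<in> K" "b \<in> K" "a \<noteq> b" "\<bar>l a\<bar> = \<bar>l b\<bar>" for s K a b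
        using that unfolding alternating_def inj_on_def by blast
      have only: "r = t \<or> r = y" if "alternating s l (?J - {r})" for r s
        using no_tie[of t "?J - {r}" y s] that y ty by auto
      have "\<not> alternating s l ?J" for s
        using no_tie[of t ?J y s] y ty by auto
      moreover have "even (card {r\<in>?J. alternating True l (?J - {r})})"
      proof (cases "\<exists>z\<in>I - {y}. \<bar>l z\<bar> = \<bar>l t\<bar>")
        case True
        then obtain z where z: "z \<in> I" "z \<noteq> y" "\<bar>l z\<bar> = \<bar>l t\<bar>" by blast
        have zy: "\<bar>l z\<bar> = \<bar>l y\<bar>" and zt: "z \<noteq> t" using z y tI by auto
        have "z \<in> ?J - {t}" "y \<in> ?J - {t}" using z(1) y(1) tI by blast+
        from no_tie[OF this z(2) zy] have nt: "\<not> alternating True l (?J - {t})" .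
        have "z \<in> ?J - {y}" "t \<in> ?J - {y}" using z(1,2) y(1) tI by blast+
        from no_tie[OF this zt z(3)] have ny: "\<not> alternating True l (?J - {y})" .
        have none: "\<not> alternating True l (?J - {r})" for r
        proof
          assume r: "alternating True l (?J - {r})"
          from only[OF this] r nt ny show False by (elim disjE) simp_all
        qed
        then have "{r\<in>?J. alternating True l (?J - {r})} = {}" by blast
        then show ?thesis by (elim ssubst) simp
      next
        case False
        then have less: "\<bar>l z\<bar> < \<bar>l t\<bar>" if "z \<in> I - {y}" for z
          using insert.hyps(2)[of z] that by force
        have "?J - {t} = insert y (I - {y})" "?J - {y} = insert t (I - {y})"
          using y tI by auto
        moreover have "alternating True l (insert y (I - {y})) = alternating True l (insert t (I - {y}))"
          using alternating_insert_max[of "I - {y}" y l True]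
            alternating_insert_max[of "I - {y}" t l True] insert.hyps(1) less tI
          unfolding ly by blast
        ultimately have "alternating True l (?J - {t}) = alternating True l (?J - {y})"
          by metis
        then have "{r\<in>?J. alternating True l (?J - {r})} = {} \<or>
            {r\<in>?J. alternating True l (?J - {r})} = {t, y}"
          using only[of True] y(1) by blast
        then show ?thesis using ty by (elim disjE ssubst) simp_all
      qed
      ultimately show ?thesis by simp
    next
      case False
      then have less: "\<bar>l z\<bar> < \<bar>l t\<bar>" if "z \<in> I" for z
        using insert.hyps(2)[of z] that by force
      define N where "N = {r\<in>I. alternating True l (I - {r})}"
      have fN: "finite N" "t \<notin> N" using insert.hyps(1) tI by (auto simp: N_def)
      have IH: "odd (card N) \<longleftrightarrow> alternating True l I \<noteq> alternating False l I"
        unfolding N_def using insert.IH insert.prems by auto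
      have top: "alternating s l ?J \<longleftrightarrow> alternating s l I \<and> (0 < l t \<longleftrightarrow> even (card I) = s)" for s
        using alternating_insert_max[of I t l s] insert.hyps(1) tI less by blast
      have facet: "alternating True l (?J - {r}) \<longleftrightarrow>
          alternating True l (I - {r}) \<and> (0 < l t \<longleftrightarrow> odd (card I))" if "r \<in> I" for r
      proof -
        have "?J - {r} = insert t (I - {r})" using that tI by auto
        moreover have "even (card (I - {r})) \<longleftrightarrow> odd (card I)"
          using that insert.hyps(1) card_Suc_Diff1[of I r] by (metis even_Suc)
        moreover have "alternating True l (insert t (I - {r})) \<longleftrightarrow>
            alternating True l (I - {r}) \<and> (0 < l t \<longleftrightarrow> even (card (I - {r})) = True)"
          using alternating_insert_max[of "I - {r}" t l True] insert.hyps(1) tI less by blast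
        ultimately show ?thesis by metis
      qed
      \<comment> \<open>The facet that omits \<open>t\<close> and those that contain \<open>t\<close> are counted separately.\<close>
      have J: "{r\<in>?J. alternating True l (?J - {r})} =
          (if alternating True l I then {t} else {}) \<union>
          (if 0 < l t \<longleftrightarrow> odd (card I) then N else {})"
        using facet tI by (auto simp: N_def)
      show ?thesis unfolding J using top IH fN by auto
    qed
  qed
qed


section \<open>Flags of faces on the boundary of a cube\<close>

text \<open>
  The box is \<open>[-R, R]\<^sup>d\<^sup>+\<^sup>1\<close> with \<open>R\<close> even, cut into cubes of side 2 with even vertices. A face is
  represented by its centre: an even coordinate is fixed on the face, an odd coordinate stands for
  the interval of length 2 around it, so the dimension of a face is the number of its odd
  coordinates. All points are sequences of integers that vanish beyond index \<open>d\<close>, so that the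
  spheres of lower dimension are subsets of those of higher dimension.
\<close>

definition cube_facet :: "(nat \<Rightarrow> int) \<Rightarrow> (nat \<Rightarrow> int) \<Rightarrow> bool" where
  "cube_facet x y \<longleftrightarrow> (\<exists>i a. odd (y i) \<and> \<bar>a\<bar> = 1 \<and> x = y(i := y i + a))"

definition top_face :: "int \<Rightarrow> nat \<Rightarrow> (nat \<Rightarrow> int) \<Rightarrow> bool" where
  "top_face R d z \<longleftrightarrow> (\<forall>i>d. z i = 0) \<and>
     (\<exists>j\<le>d. \<bar>z j\<bar> = R \<and> (\<forall>i\<le>d. i \<noteq> j \<longrightarrow> odd (z i) \<and> \<bar>z i\<bar> < R))"

text \<open>
  The successive facets below a top face are faces of the boundary, of all dimensions, without
  further conditions. The value beyond \<open>d\<close> is fixed so that a flag is determined by its faces.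
\<close>

definition flag :: "int \<Rightarrow> nat \<Rightarrow> (nat \<Rightarrow> nat \<Rightarrow> int) \<Rightarrow> bool" where
  "flag R d F \<longleftrightarrow> top_face R d (F d) \<and> (\<forall>r<d. cube_facet (F r) (F (Suc r))) \<and>
     (\<forall>r>d. F r = (\<lambda>_. 0))"

definition on_sphere :: "int \<Rightarrow> nat \<Rightarrow> (nat \<Rightarrow> int) \<Rightarrow> bool" where
  "on_sphere R d x \<longleftrightarrow> (\<forall>i>d. x i = 0) \<and> (\<forall>i. \<bar>x i\<bar> \<le> R) \<and> (\<exists>i\<le>d. \<bar>x i\<bar> = R)"

text \<open>
  The next three lemmas count in how many ways one face of a flag can be exchanged. A face of
  dimension 0 is one of the two ends of an edge.
\<close>

lemma cube_facet_vertices: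
  assumes "card {i. odd (z i)} = 1" "cube_facet x z"
  shows "\<exists>x'. x' \<noteq> x \<and> (\<forall>g. cube_facet g z \<longleftrightarrow> g = x \<or> g = x')"
proof -
  obtain i where i: "{i. odd (z i)} = {i}" using assms(1) card_1_singletonE by blast
  then have odd: "odd (z j) \<longleftrightarrow> j = i" for j by auto
  obtain a where a: "\<bar>a\<bar> = 1" "x = z(i := z i + a)"
    using assms(2) odd by (auto simp: cube_facet_def)
  have "z(i := z i - a) \<noteq> x" using a by (auto simp: fun_eq_iff)
  moreover have "cube_facet g z \<longleftrightarrow> g = x \<or> g = z(i := z i - a)" for g
  proof
    assume "cube_facet g z"
    then obtain b where b: "\<bar>b\<bar> = 1" "g = z(i := z i + b)"
      using odd by (auto simp: cube_facet_def)
    then have "b = a \<or> b = - a" using a by linarith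
    then show "g = x \<or> g = z(i := z i - a)" using a b by auto
  next
    assume "g = x \<or> g = z(i := z i - a)"
    moreover have "cube_facet (z(i := z i - a)) z"
      unfolding cube_facet_def using odd a by (intro exI[of _ i] exI[of _ "- a"]) auto
    ultimately show "cube_facet g z" using assms(2) by blast
  qed
  ultimately show ?thesis by blast
qed

text \<open>
  Two odd coordinates of \<open>z\<close> are changed to reach \<open>x\<close>; the order in which this is done
  determines the face in between.
\<close>

lemma cube_facet_diamond:
  assumes "cube_facet x y" "cube_facet y z"
  shows "\<exists>y'. y' \<noteq> y \<and> (\<forall>g. cube_facet x g \<and> cube_facet g z \<longleftrightarrow> g = y \<or> g = y')"
proof -
  obtain i a where i: "odd (z i)" "\<bar>a\<bar> = 1" "y = z(i := z i + a)"
    using assms(2) by (auto simp: cube_facet_def)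
  obtain j b where j: "odd (y j)" "\<bar>b\<bar> = 1" "x = y(j := y j + b)"
    using assms(1) by (auto simp: cube_facet_def)
  have "odd a" "odd b" using i j by (auto simp: abs_if split: if_splits)
  have ij: "i \<noteq> j" using i j by (auto simp: \<open>odd a\<close>)
  define y' where "y' = z(j := z j + b)"
  have x: "x = z(i := z i + a, j := z j + b)" using i j ij by auto
  have zj: "odd (z j)" using j i ij by auto
  have "a \<noteq> 0" "b \<noteq> 0" using i j by auto
  have "y' \<noteq> y" using ij i \<open>a \<noteq> 0\<close> by (auto simp: y'_def fun_eq_iff)
  moreover have "cube_facet x g \<and> cube_facet g z \<longleftrightarrow> g = y \<or> g = y'" for g
  proof
    assume g: "cube_facet x g \<and> cube_facet g z"
    then obtain m c where m: "odd (z m)" "\<bar>c\<bar> = 1" "g = z(m := z m + c)"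
      by (auto simp: cube_facet_def)
    obtain n e where n: "odd (g n)" "\<bar>e\<bar> = 1" "x = g(n := g n + e)"
      using g by (auto simp: cube_facet_def)
    have "odd c" using m by (auto simp: abs_if split: if_splits)
    have mn: "m \<noteq> n" using m n by (auto simp: \<open>odd c\<close>)
    have x2: "x = z(m := z m + c, n := z n + e)" using m n mn by auto
    have "x m = z m + c" using x2 mn by simp
    then have "m = i \<and> c = a \<or> m = j \<and> c = b"
      using m(2) x ij by (auto split: if_splits)
    then show "g = y \<or> g = y'" using m i by (auto simp: y'_def)
  next
    assume "g = y \<or> g = y'"
    moreover have "cube_facet y' z"
      unfolding cube_facet_def y'_def using zj j by blast
    moreover have "cube_facet x y'"
      unfolding cube_facet_def y'_def x using i ij
      by (intro exI[of _ i] exI[of _ a]) auto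
    ultimately show "cube_facet x g \<and> cube_facet g z" using assms by blast
  qed
  ultimately show ?thesis by blast
qed

text \<open>
  A face \<open>y\<close> of dimension one less than the sphere has two even coordinates. If both are \<open>R\<close> or
  \<open>-R\<close>, then \<open>y\<close> is on an edge of the box, and moving either of them inwards gives a top face. If
  only one is, the other can be moved up or down. Both resulting faces are in the upper half unless
  the second coordinate is the last one and is 0, that is, unless \<open>y\<close> lies on the equator.
\<close>

lemma top_face_neighbour:
  assumes R: "even R" "2 \<le> R" and z: "top_face R D z" "0 < z D"
    and y: "cube_facet y z" "y D \<noteq> 0"
  shows "\<exists>z'. z' \<noteq> z \<and> (\<forall>g. top_face R D g \<and> cube_facet y g \<and> 0 < g D \<longleftrightarrow> g = z \<or> g = z')"
proof -
  obtain j where j: "j \<le> D" "\<bar>z j\<bar> = R" "\<And>i. i \<le> D \<Longrightarrow> i \<noteq> j \<Longrightarrow> odd (z i) \<and> \<bar>z i\<bar> < R"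
    and z0: "\<And>i. i > D \<Longrightarrow> z i = 0"
    using z(1) by (auto simp: top_face_def)
  obtain i a where i: "odd (z i)" "\<bar>a\<bar> = 1" "y = z(i := z i + a)"
    using y(1) by (auto simp: cube_facet_def)
  have evR: "even (z j)" using R j(2) by (metis dvd_abs_iff)
  have ij: "i \<noteq> j" using i evR by auto
  have iD: "i \<le> D" using i z0 by (cases "i \<le> D") auto
  have zi: "\<bar>z i\<bar> < R" using j(3) iD ij by auto
  have oa: "odd a" using i(2) by (auto simp: abs_if split: if_splits)
  have yi: "y i = z i + a" "even (y i)" using i oa by auto
  have yiR: "\<bar>y i\<bar> \<le> R" using zi i(2) yi by linarith
  have yj: "y j = z j" using i ij by auto
  have y_other: "y m = z m" if "m \<noteq> i" for m using i that by auto
  have yD: "0 < y D"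
  proof (cases "i = D")
    case True
    then show ?thesis using y(2) yi z(2) i(2) by auto
  qed (use y_other z(2) in auto)
  have g_form: "\<exists>m c. \<bar>c\<bar> = 1 \<and> g = y(m := y m + c) \<and> (m = i \<or> m = j) \<and> even (y m)"
    if g: "top_face R D g" "cube_facet y g" for g
  proof -
    obtain m c where m: "odd (g m)" "\<bar>c\<bar> = 1" "y = g(m := g m + c)"
      using g(2) by (auto simp: cube_facet_def)
    have "odd c" using m(2) by (auto simp: abs_if split: if_splits)
    have ev: "even (y m)" using m \<open>odd c\<close> by auto
    have "m \<le> D" using m(1) g(1) by (cases "m \<le> D") (auto simp: top_face_def)
    then have "m = i \<or> m = j" using j(3) y_other ev by metis
    moreover have "g = y(m := y m + (- c))" using m by auto
    ultimately show ?thesis using m(2) ev by (metis abs_minus_cancel)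
  qed
  show ?thesis
  proof (cases "\<bar>y i\<bar> = R")
    case True
    \<comment> \<open>\<open>y\<close> lies on an edge of the box: the other top face is reached by moving coordinate \<open>j\<close> inwards.\<close>
    define z' where "z' = y(j := y j - sgn (y j))"
    have sg: "\<bar>sgn (y j)\<bar> = 1" "\<bar>y j - sgn (y j)\<bar> = R - 1"
      using yj j(2) R by (auto simp: sgn_if abs_if)
    have os: "odd (sgn (y j))" using sg(1) by (auto simp: abs_if split: if_splits)
    have "z' \<noteq> z" using yj sg(1) by (auto simp: z'_def fun_eq_iff sgn_if split: if_splits intro!: exI[of _ j])
    moreover have t: "top_face R D z'"
      unfolding top_face_def
    proof (intro conjI exI[of _ i] allI impI)
      fix m assume "m > D" then show "z' m = 0"
        using j(1) iD y_other[of m] z0 by (auto simp: z'_def)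
    next
      fix m assume m: "m \<le> D" "m \<noteq> i"
      show "odd (z' m)" using j(3)[of m] y_other m os evR yj by (auto simp: z'_def)
      show "\<bar>z' m\<bar> < R" using j(3)[of m] y_other m sg by (auto simp: z'_def)
    qed (use iD True ij in \<open>auto simp: z'_def\<close>)
    moreover have f: "cube_facet y z'"
      unfolding cube_facet_def z'_def using os sg(1) evR yj
      by (intro exI[of _ j] exI[of _ "sgn (y j)"]) (auto simp: fun_eq_iff)
    moreover have "0 < z' D"
      using yD j(2) yj R by (auto simp: z'_def sgn_if)
    moreover have "g = z \<or> g = z'" if g: "top_face R D g" "cube_facet y g" for g
    proof -
      obtain m c where m: "\<bar>c\<bar> = 1" "g = y(m := y m + c)" "m = i \<or> m = j"
        using g_form[OF g] by blast
      have gR: "\<bar>g n\<bar> \<le> R" for n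
        using g(1) R by (cases "n \<le> D") (auto simp: top_face_def intro: less_imp_le)
      show ?thesis
      proof (cases "m = i")
        case True
        then have "c = - a" using gR[of i] m \<open>\<bar>y i\<bar> = R\<close> zi yi i(2) by auto
        then show ?thesis using m True i yi by auto
      next
        case False
        then have "m = j" using m by auto
        moreover have "c = - sgn (y j)"
          using gR[of j] m \<open>m = j\<close> j(2) yj R by (auto simp: sgn_if)
        ultimately show ?thesis using m by (auto simp: z'_def)
      qed
    qed
    ultimately show ?thesis using z y(1) by blast
  next
    case False
    then have lt: "\<bar>y i\<bar> < R" using yiR by auto
    \<comment> \<open>\<open>y\<close> is inside a side of the box: the other top face is the reflection of \<open>z\<close> in \<open>y\<close>.\<close>
    define z' where "z' = y(i := y i + a)"
    have lt': "\<bar>y i + a\<bar> < R"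
    proof -
      have "\<bar>y i + a\<bar> \<noteq> R" using R yi oa by (metis dvd_abs_iff even_add)
      then show ?thesis using lt i(2) by linarith
    qed
    have "a \<noteq> 0" using i(2) by auto
    then have "z' \<noteq> z" using yi by (auto simp: z'_def fun_eq_iff intro!: exI[of _ i])
    moreover have "top_face R D z'"
      unfolding top_face_def
    proof (intro conjI exI[of _ j] allI impI)
      fix m assume "m > D" then show "z' m = 0"
        using j(1) iD y_other[of m] z0 by (auto simp: z'_def)
    next
      fix m assume m: "m \<le> D" "m \<noteq> j"
      show "odd (z' m)" using j(3)[of m] y_other[of m] m oa yi by (auto simp: z'_def)
      show "\<bar>z' m\<bar> < R" using j(3)[of m] y_other[of m] m lt' by (auto simp: z'_def)
    qed (use j yj ij in \<open>auto simp: z'_def\<close>)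
    moreover have "cube_facet y z'"
      unfolding cube_facet_def z'_def using oa yi i(2)
      by (intro exI[of _ i] exI[of _ "- a"]) (auto simp: fun_eq_iff)
    moreover have "0 < z' D"
    proof (cases "i = D")
      case True
      then have "2 \<le> y D" using yD yi(2) by presburger
      then show ?thesis using i(2) True by (auto simp: z'_def)
    qed (use yD in \<open>auto simp: z'_def\<close>)
    moreover have "g = z \<or> g = z'" if g: "top_face R D g" "cube_facet y g" for g
    proof -
      obtain m c where m: "\<bar>c\<bar> = 1" "g = y(m := y m + c)" "m = i \<or> m = j" "even (y m)"
        using g_form[OF g] by blast
      have "odd c" using m(1) by (auto simp: abs_if split: if_splits)
      have "m \<noteq> j"
      proof
        assume "m = j"
        obtain n where n: "n \<le> D" "\<bar>g n\<bar> = R"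
          using g(1) by (auto simp: top_face_def)
        then have "n \<noteq> i" using m \<open>m = j\<close> ij lt by auto
        moreover have "n \<noteq> j"
        proof
          assume "n = j"
          then have "even (g j)" using n R by (metis dvd_abs_iff)
          then show False using m \<open>m = j\<close> \<open>odd c\<close> by auto
        qed
        ultimately have "\<bar>z n\<bar> = R" using m \<open>m = j\<close> n y_other by auto
        then show False using j(3)[of n] n \<open>n \<noteq> j\<close> by auto
      qed
      then have "m = i" using m by auto
      moreover have "c = a \<or> c = - a" using m(1) i(2) by linarith
      ultimately show ?thesis using m i yi by (auto simp: z'_def)
    qed
    ultimately show ?thesis using z y(1) by blast
  qed
qed

text \<open>
  A face on the equator has exactly one top face of the upper half above it, and conversely every
  top face of the lower sphere occurs in this way.
\<close>

lemma top_face_over_equator: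
  assumes R: "even R" "2 \<le> R" and z: "top_face R (Suc d) z" "0 < z (Suc d)"
    and y: "cube_facet y z" "y (Suc d) = 0"
  shows "z = y(Suc d := 1)" "top_face R d y"
proof -
  obtain i a where i: "odd (z i)" "\<bar>a\<bar> = 1" "y = z(i := z i + a)"
    using y(1) by (auto simp: cube_facet_def)
  have iD: "i = Suc d" using i z(2) y(2) by (auto split: if_splits)
  then have z1: "z (Suc d) = 1" using i z(2) y(2) by auto
  then show *: "z = y(Suc d := 1)" using i iD by (auto simp: fun_eq_iff)
  obtain j where j: "j \<le> Suc d" "\<bar>z j\<bar> = R"
    "\<And>i. i \<le> Suc d \<Longrightarrow> i \<noteq> j \<Longrightarrow> odd (z i) \<and> \<bar>z i\<bar> < R"
    and z0: "\<And>i. i > Suc d \<Longrightarrow> z i = 0"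
    using z(1) by (auto simp: top_face_def)
  have jd: "j \<le> d" using j(1,2) z1 R by (cases "j = Suc d") auto
  show "top_face R d y"
    unfolding top_face_def
  proof (intro conjI exI[of _ j] allI impI)
    fix m assume "d < m" then show "y m = 0"
      using z0[of m] y(2) * by (cases "m = Suc d") auto
  next
    fix m assume m: "m \<le> d" "m \<noteq> j"
    show "odd (y m)" "\<bar>y m\<bar> < R" using j(3)[of m] m * by auto
  qed (use jd j * in auto)
qed

lemma top_face_lift:
  assumes R: "2 \<le> R" and y: "top_face R d y"
  shows "top_face R (Suc d) (y(Suc d := 1))" "cube_facet y (y(Suc d := 1))"
proof -
  have y0: "y (Suc d) = 0" using y by (auto simp: top_face_def)
  show "cube_facet y (y(Suc d := 1))"
    unfolding cube_facet_def by (intro exI[of _ "Suc d"] exI[of _ "-1"]) (auto simp: y0 fun_eq_iff)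
  obtain j where j: "j \<le> d" "\<bar>y j\<bar> = R" "\<And>i. i \<le> d \<Longrightarrow> i \<noteq> j \<Longrightarrow> odd (y i) \<and> \<bar>y i\<bar> < R"
    and z0: "\<And>i. i > d \<Longrightarrow> y i = 0"
    using y by (auto simp: top_face_def)
  show "top_face R (Suc d) (y(Suc d := 1))"
    unfolding top_face_def
    by (intro conjI exI[of _ j]) (use j z0 R in \<open>auto simp: le_Suc_eq\<close>)
qed

text \<open>
  Going down in a flag, the fixed coordinates stay and an interval can only shrink to one of its
  ends. Hence any two faces of a flag have centres that differ by at most 1 in every coordinate.
\<close>

lemma flag_coord:
  assumes F: "flag R d F" and "r \<le> s" "s \<le> d"
  shows "if even (F s i) then F r i = F s i else \<bar>F r i - F s i\<bar> \<le> 1"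
  using assms(2,3)
proof (induction r rule: inc_induct)
  case (step r)
  have "cube_facet (F r) (F (Suc r))"
    using F step.hyps step.prems by (auto simp: flag_def)
  then obtain j a where j: "odd (F (Suc r) j)" "\<bar>a\<bar> = 1" "F r = (F (Suc r))(j := F (Suc r) j + a)"
    unfolding cube_facet_def by blast
  have IH: "if even (F s i) then F (Suc r) i = F s i else \<bar>F (Suc r) i - F s i\<bar> \<le> 1"
    using step.IH step.prems by simp
  show ?case
  proof (cases "i = j")
    case True
    have os: "odd (F s i)" using IH j(1) True by (auto split: if_splits)
    then have "F (Suc r) i = F s i"
      using IH j(1) True by (auto split: if_splits) presburger
    then show ?thesis using os j True by simp
  qed (use IH j in simp)
qed simp

lemma flag_close:
  assumes F: "flag R d F" and "r \<le> d" "s \<le> d"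
  shows "\<bar>F r i - F s i\<bar> \<le> 1"
proof (cases "r \<le> s")
  case True
  show ?thesis using flag_coord[OF F True assms(3), of i] by (auto split: if_splits)
next
  case False
  then show ?thesis using flag_coord[OF F _ assms(2), of s i] by (auto split: if_splits)
qed

lemma flag_on_sphere:
  assumes R: "even R" and F: "flag R d F" and "r \<le> d"
  shows "on_sphere R d (F r)"
proof -
  obtain j where j: "j \<le> d" "\<bar>F d j\<bar> = R" "\<And>i. i \<le> d \<Longrightarrow> i \<noteq> j \<Longrightarrow> odd (F d i) \<and> \<bar>F d i\<bar> < R"
    and z0: "\<And>i. i > d \<Longrightarrow> F d i = 0"
    using F unfolding flag_def top_face_def by blast
  have c: "if even (F d i) then F r i = F d i else \<bar>F r i - F d i\<bar> \<le> 1" for i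
    using flag_coord[OF F assms(3)] by simp
  have ev: "even (F d j)" using R j(2) by (metis dvd_abs_iff)
  have rj: "F r j = F d j" using c[of j] ev by simp
  have r0: "F r i = 0" if "i > d" for i using c[of i] z0[OF that] by simp
  have "\<bar>F r i\<bar> \<le> R" for i
  proof (cases "i \<le> d \<and> i \<noteq> j")
    case True
    then have "odd (F d i)" "\<bar>F d i\<bar> < R" using j(3) by auto
    moreover have "\<bar>F r i - F d i\<bar> \<le> 1" using c[of i] \<open>odd (F d i)\<close> by simp
    ultimately show ?thesis by linarith
  next
    case False
    then show ?thesis using r0[of i] rj j(2) by (cases "i = j") auto
  qed
  then show ?thesis unfolding on_sphere_def using r0 rj j(1,2) by metis
qed

lemma finite_bounded_functions:
  assumes "finite A"
  shows "finite {f. (\<forall>i\<le>d. f i \<in> A) \<and> (\<forall>i>(d::nat). f i = c)}"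
proof -
  have "{f. (\<forall>i\<le>d. f i \<in> A) \<and> (\<forall>i>d. f i = c)} =
      {f. \<forall>i. (i \<in> {..d} \<longrightarrow> f i \<in> A) \<and> (i \<notin> {..d} \<longrightarrow> f i = c)}"
    by (auto simp: not_le)
  then show ?thesis using finite_set_of_finite_funs[of "{..d}" A c] assms by simp
qed

lemma finite_flags:
  assumes "even R" shows "finite {F. flag R d F}"
proof -
  have "finite {x. on_sphere R d x}"
  proof (rule finite_subset[OF _ finite_bounded_functions[of "{-R..R}" d 0]])
    have "x i \<in> {-R..R}" if "\<bar>x i\<bar> \<le> R" for x :: "nat \<Rightarrow> int" and i
      using that by auto
    then show "{x. on_sphere R d x} \<subseteq> {x. (\<forall>i\<le>d. x i \<in> {-R..R}) \<and> (\<forall>i>d. x i = 0)}"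
      unfolding on_sphere_def by blast
  qed simp
  from finite_bounded_functions[OF this, of d "\<lambda>_. 0"]
  have "finite {F. (\<forall>r\<le>d. on_sphere R d (F r)) \<and> (\<forall>r>d. F r = (\<lambda>_. 0))}" by simp
  then show ?thesis
    by (rule finite_subset[rotated]) (use flag_on_sphere[OF assms] in \<open>auto simp: flag_def\<close>)
qed

lemma card_odd_coords:
  assumes R: "even R" and F: "flag R d F" and "r \<le> d"
  shows "card {i. odd (F r i)} = r"
proof -
  have fin: "finite {i. odd (F r i)}" if "r \<le> d" for r
    by (rule finite_subset[of _ "{..d}"])
      (use flag_on_sphere[OF R F that] in \<open>auto simp: on_sphere_def not_le[symmetric]\<close>)
  show "card {i. odd (F r i)} = r"
    using assms(3)
  proof (induction r rule: inc_induct)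
    case base
    obtain j where j: "j \<le> d" "\<bar>F d j\<bar> = R" "\<And>i. i \<le> d \<Longrightarrow> i \<noteq> j \<Longrightarrow> odd (F d i)"
      and z0: "\<And>i. i > d \<Longrightarrow> F d i = 0"
      using F unfolding flag_def top_face_def by blast
    have "even (F d j)" using R j(2) by (metis dvd_abs_iff)
    moreover have "i \<le> d" if "odd (F d i)" for i
      using z0[of i] that by (cases "i \<le> d") auto
    ultimately have "{i. odd (F d i)} = {..d} - {j}"
      using j(3) by blast
    then show ?case using j(1) by simp
  next
    case (step r)
    have "cube_facet (F r) (F (Suc r))"
      using F step.hyps by (auto simp: flag_def)
    then obtain j a where j: "odd (F (Suc r) j)" "\<bar>a\<bar> = 1" "F r = (F (Suc r))(j := F (Suc r) j + a)"
      unfolding cube_facet_def by blast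
    have "odd a" using j(2) by (auto simp: abs_if split: if_splits)
    then have "{i. odd (F r i)} = {i. odd (F (Suc r) i)} - {j}"
      using j by auto
    then show ?case using step.IH j(1) fin[of "Suc r"] step.hyps by simp
  qed
qed

text \<open>
  The triangulation is a pseudomanifold: in a flag of the upper half-sphere, every face can be
  exchanged for exactly one other, except for a top face over the equator.
\<close>

lemma flag_exchange:
  assumes R: "even R" "2 \<le> R" and F: "flag R D F" "0 < F D D" and "r \<le> D" "0 < D"
    and int: "r = D \<Longrightarrow> F (D - 1) D \<noteq> 0"
  shows "\<exists>G. G \<noteq> F r \<and> (\<forall>g. flag R D (F(r := g)) \<and> 0 < (F(r := g)) D D \<longleftrightarrow> g = F r \<or> g = G)"
proof -
  have top: "top_face R D (F D)" and facet: "\<And>q. q < D \<Longrightarrow> cube_facet (F q) (F (Suc q))"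
    and zero: "\<And>q. q > D \<Longrightarrow> F q = (\<lambda>_. 0)"
    using F by (auto simp: flag_def)
  consider "r = D" | "r = 0" | "0 < r" "r < D" using \<open>r \<le> D\<close> by linarith
  then show ?thesis
  proof cases
    case 1
    obtain n where D: "D = Suc n" using \<open>0 < D\<close> gr0_implies_Suc by blast
    have "flag R D (F(D := g)) \<and> 0 < (F(D := g)) D D \<longleftrightarrow>
        top_face R D g \<and> cube_facet (F n) g \<and> 0 < g D" for g
      using facet zero unfolding flag_def D by (auto simp: less_Suc_eq)
    then show ?thesis
      using top_face_neighbour[OF R top F(2), of "F n"] facet[of n] int 1 unfolding D by simp
  next
    case 2
    have "flag R D (F(0 := g)) \<and> 0 < (F(0 := g)) D D \<longleftrightarrow> cube_facet g (F 1)" for g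
      using top facet zero F(2) \<open>0 < D\<close> unfolding flag_def by auto
    moreover have "card {i. odd (F 1 i)} = 1"
      using card_odd_coords[OF R(1) F(1), of 1] \<open>0 < D\<close> by simp
    ultimately show ?thesis
      using cube_facet_vertices[of "F 1" "F 0"] facet[of 0] \<open>0 < D\<close> 2 by simp
  next
    case 3
    then obtain q where q: "r = Suc q" using gr0_implies_Suc by blast
    have "flag R D (F(r := g)) \<and> 0 < (F(r := g)) D D \<longleftrightarrow>
        cube_facet (F q) g \<and> cube_facet g (F (Suc r))" for g
    proof
      assume a: "flag R D (F(r := g)) \<and> 0 < (F(r := g)) D D"
      then have "\<And>m. m < D \<Longrightarrow> cube_facet ((F(r := g)) m) ((F(r := g)) (Suc m))"
        by (simp only: flag_def)
      from this[of q] this[of r] show "cube_facet (F q) g \<and> cube_facet g (F (Suc r))"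
        using 3 q by simp
    next
      assume "cube_facet (F q) g \<and> cube_facet g (F (Suc r))"
      then show "flag R D (F(r := g)) \<and> 0 < (F(r := g)) D D"
        using top facet zero F(2) 3 q unfolding flag_def by auto
    qed
    then show ?thesis
      using cube_facet_diamond[of "F q" "F r" "F (Suc r)"] facet[of q] facet[of r] 3 q by simp
  qed
qed

lemma even_card_if_fibres_have_two:
  assumes "finite A" "\<And>x. x \<in> A \<Longrightarrow> card {y \<in> A. g y = g x} = 2"
  shows "even (card A)"
proof -
  have "card A = (\<Sum>z\<in>g ` A. card {y \<in> A. g y = z})"
    using sum.image_gen[OF assms(1), of "\<lambda>_. 1::nat" g] by simp
  also have "\<dots> = (\<Sum>z\<in>g ` A. 2)"
    by (rule sum.cong) (use assms(2) in auto)
  finally show ?thesis by simp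
qed

lemma cube_facet_uminus: "cube_facet (- x) (- y) \<longleftrightarrow> cube_facet x y"
proof -
  have *: "cube_facet (- x) (- y)" if xy: "cube_facet x y" for x y :: "nat \<Rightarrow> int"
  proof -
    obtain i a where "odd (y i)" "\<bar>a\<bar> = 1" "x = y(i := y i + a)"
      using xy unfolding cube_facet_def by blast
    then show ?thesis
      unfolding cube_facet_def by (intro exI[of _ i] exI[of _ "- a"]) (auto simp: fun_eq_iff)
  qed
  show ?thesis using *[of x y] *[of "- x" "- y"] by (auto simp: fun_Compl_def)
qed

lemma flag_uminus: "flag R d (\<lambda>r. - F r) \<longleftrightarrow> flag R d F"
  by (auto simp: flag_def cube_facet_uminus top_face_def fun_eq_iff)

text \<open>
  Ky Fan's lemma, by induction on the dimension. Count the pairs of a flag in the upper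
  half-sphere and a facet of it that alternates starting with a positive label. Counted by flags,
  their number has the parity of the number of flags in the upper half that alternate in either
  sense. As the antipodal map exchanges the two halves and the two senses, this is the number of
  alternating flags of the whole sphere that start with a positive label. Counted by facets, every
  facet inside the half-sphere belongs to two flags and every facet on the equator to one, so the
  parity is that of the corresponding number for the equator.
\<close>

lemma odd_card_alternating_flags:
  assumes R: "even R" "2 \<le> R"
    and anti: "\<And>x. on_sphere R d x \<Longrightarrow> lab (- x) = - lab x"
    and compl: "\<And>x y. on_sphere R d x \<Longrightarrow> on_sphere R d y \<Longrightarrow>
                  (\<And>i. \<bar>x i - y i\<bar> \<le> 1) \<Longrightarrow> lab x \<noteq> - lab y"
  shows "odd (card {F. flag R d F \<and> alternating True (\<lambda>r. lab (F r)) {..d}})"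
  using anti compl
proof (induction d)
  case 0
  have lab0: "lab x \<noteq> 0" if "on_sphere R 0 x" for x
    using "0.prems"(2)[OF that that] by auto
  define P :: "nat \<Rightarrow> nat \<Rightarrow> int" where "P = (\<lambda>r i. if r = 0 \<and> i = 0 then R else 0)"
  have flags: "flag R 0 F \<longleftrightarrow> F = P \<or> F = (\<lambda>r. - P r)" for F
  proof
    assume "flag R 0 F"
    then have z: "\<And>i. i > 0 \<Longrightarrow> F 0 i = 0" "\<bar>F 0 0\<bar> = R" "\<And>r. r > 0 \<Longrightarrow> F r = (\<lambda>_. 0)"
      by (auto simp: flag_def top_face_def)
    have "F r i = (if F 0 0 = R then P r i else - P r i)" for r i
      using z(1)[of i] z(2) z(3)[of r] by (cases "r = 0"; cases "i = 0") (auto simp: P_def)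
    then show "F = P \<or> F = (\<lambda>r. - P r)"
      by (cases "F 0 0 = R") (simp_all add: fun_eq_iff)
  next
    assume "F = P \<or> F = (\<lambda>r. - P r)"
    then show "flag R 0 F" using R by (auto simp: flag_def top_face_def P_def fun_eq_iff)
  qed
  have alt: "alternating True (\<lambda>r. lab (F r)) {..0} \<longleftrightarrow> 0 < lab (F 0)"
    for F :: "nat \<Rightarrow> nat \<Rightarrow> int"
    by (simp add: alternating_def cong: conj_cong)
  have P: "on_sphere R 0 (P 0)" using flag_on_sphere[OF R(1), of 0 P 0] flags by blast
  have "P 0 0 \<noteq> - P 0 0" using R by (simp add: P_def)
  then have "P \<noteq> (\<lambda>r. - P r)" by (metis uminus_apply)
  moreover have "lab (- P 0) = - lab (P 0)" "lab (P 0) \<noteq> 0"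
    using "0.prems"(1)[OF P] lab0[OF P] by blast+
  ultimately have "{F. flag R 0 F \<and> alternating True (\<lambda>r. lab (F r)) {..0}} =
      (if 0 < lab (P 0) then {P} else {\<lambda>r. - P r})"
    unfolding alt flags by auto
  then show ?case by simp
next
  case (Suc d)
  let ?D = "Suc d"
  define Fl where "Fl = {F. flag R ?D F}"
  define U where "U = {F \<in> Fl. 0 < F ?D ?D}"
  define lb :: "(nat \<Rightarrow> nat \<Rightarrow> int) \<Rightarrow> nat \<Rightarrow> int" where "lb = (\<lambda>F r. lab (F r))"
  define A where "A s = {F \<in> Fl. alternating s (lb F) {..?D}}" for s
  have finFl: "finite Fl" unfolding Fl_def by (rule finite_flags[OF R(1)])
  have finU: "finite U" using finFl by (simp add: U_def)
  have sph: "on_sphere R ?D (F r)" if "F \<in> Fl" "r \<le> ?D" for F r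
    using flag_on_sphere[OF R(1)] that by (simp add: Fl_def)
  have lab_compl: "lb F r \<noteq> - lb F q" if "F \<in> Fl" "r \<le> ?D" "q \<le> ?D" for F r q
    unfolding lb_def
    by (rule Suc.prems(2)) (use sph flag_close[of R ?D F] that in \<open>auto simp: Fl_def\<close>)
  have lab0: "lb F r \<noteq> 0" if "F \<in> Fl" "r \<le> ?D" for F r
    using lab_compl[OF that that(2)] by auto
  have FD: "F ?D ?D \<noteq> 0" if "F \<in> Fl" for F
  proof -
    have "top_face R ?D (F ?D)" using that by (simp add: Fl_def flag_def)
    then obtain j where j: "j \<le> ?D" "\<bar>F ?D j\<bar> = R"
      "\<And>i. i \<le> ?D \<Longrightarrow> i \<noteq> j \<Longrightarrow> odd (F ?D i)"
      unfolding top_face_def by blast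
    show ?thesis using j(2) j(3)[of ?D] R by (cases "j = ?D") auto
  qed
  \<comment> \<open>The antipodal map exchanges the halves and the two senses of alternation.\<close>
  have up_neg: "card (U \<inter> A False) = card (A True - U)"
  proof (rule bij_betw_same_card[of "\<lambda>F r. - F r"])
    have neg: "(\<lambda>r. - F r) \<in> A (\<not> s)" if "F \<in> A s" for F s
    proof -
      have F: "F \<in> Fl" using that by (simp add: A_def)
      have "alternating (\<not> s) (\<lambda>r. - lb F r) {..?D}"
        using that lab0[OF F] alternating_uminus[of "{..?D}" "lb F" "\<not> s"] by (simp add: A_def)
      moreover have "lb (\<lambda>r. - F r) r = - lb F r" if "r \<in> {..?D}" for r
        using Suc.prems(1)[OF sph[OF F]] that unfolding lb_def atMost_iff by blast
      ultimately have "alternating (\<not> s) (lb (\<lambda>r. - F r)) {..?D}"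
        using alternating_cong[of "{..?D}" "lb (\<lambda>r. - F r)" "\<lambda>r. - lb F r"] by blast
      then show ?thesis using F flag_uminus by (simp add: A_def Fl_def)
    qed
    have swap: "(\<lambda>r. - F r) \<in> U \<longleftrightarrow> F \<notin> U" if "F \<in> A s" for F s
    proof -
      have "F \<in> Fl" using that by (simp add: A_def)
      then show ?thesis using flag_uminus FD[OF \<open>F \<in> Fl\<close>] by (auto simp: U_def Fl_def)
    qed
    show "bij_betw (\<lambda>F r. - F r) (U \<inter> A False) (A True - U)"
    proof (rule bij_betwI[where g = "\<lambda>F r. - F r"])
      show "(\<lambda>F r. - F r) \<in> U \<inter> A False \<rightarrow> A True - U"
        using neg[of _ False] swap[of _ False] by auto
      show "(\<lambda>F r. - F r) \<in> A True - U \<rightarrow> U \<inter> A False"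
        using neg[of _ True] swap[of _ True] by auto
    qed (simp_all add: fun_Compl_def)
  qed
  define P where "P = {(F, r). F \<in> U \<and> r \<le> ?D \<and> alternating True (lb F) ({..?D} - {r})}"
  define Q where "Q = {(F, r) \<in> P. r = ?D \<and> F d ?D = 0}"
  have P_Sigma: "P = (SIGMA F:U. {r \<in> {..?D}. alternating True (lb F) ({..?D} - {r})})"
    by (auto simp: P_def)
  have finP: "finite P" unfolding P_Sigma using finU by auto
  have QP: "Q \<subseteq> P" by (auto simp: Q_def)
  have "odd (card P) \<longleftrightarrow>
      odd (card {F \<in> U. odd (card {r \<in> {..?D}. alternating True (lb F) ({..?D} - {r})})})"
    unfolding P_Sigma using finU by (simp add: card_SigmaI even_sum_iff)
  also have "{F \<in> U. odd (card {r \<in> {..?D}. alternating True (lb F) ({..?D} - {r})})} =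
      (U \<inter> A True) \<union> (U \<inter> A False)"
  proof -
    have "odd (card {r \<in> {..?D}. alternating True (lb F) ({..?D} - {r})}) \<longleftrightarrow>
        alternating True (lb F) {..?D} \<or> alternating False (lb F) {..?D}" if "F \<in> U" for F
    proof -
      have F: "F \<in> Fl" using that by (simp add: U_def)
      have "odd (card {r \<in> {..?D}. alternating True (lb F) ({..?D} - {r})}) \<longleftrightarrow>
          alternating True (lb F) {..?D} \<noteq> alternating False (lb F) {..?D}"
        by (rule odd_alternating_facets_iff) (use lab_compl[OF F] in auto)
      then show ?thesis using alternating_not_both[of 0 "{..?D}" "lb F"] by auto
    qed
    then show ?thesis by (auto simp: A_def U_def)
  qed
  also have "card \<dots> = card (U \<inter> A True) + card (U \<inter> A False)"
    by (rule card_Un_disjoint)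
      (use finU alternating_not_both[of 0 "{..?D}"] in \<open>auto simp: A_def\<close>)
  also have "\<dots> = card (A True)"
    unfolding up_neg using finFl
    by (subst card_Un_disjoint[symmetric]) (auto simp: A_def intro!: arg_cong[of _ _ card])
  finally have P_A: "odd (card P) \<longleftrightarrow> odd (card (A True))" .
  \<comment> \<open>Interior facets are counted twice: fibres of forgetting the omitted face have two elements.\<close>
  have even_PQ: "even (card (P - Q))"
  proof (rule even_card_if_fibres_have_two[where g = "\<lambda>(F, r). (r, F(r := (\<lambda>_. 0)))"])
    fix x assume x: "x \<in> P - Q"
    obtain F r where Fr: "x = (F, r)" by fastforce
    have F: "flag R ?D F" "0 < F ?D ?D" "r \<le> ?D"
      and alt: "alternating True (lb F) ({..?D} - {r})" and nQ: "r = ?D \<Longrightarrow> F d ?D \<noteq> 0"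
      using x Fr by (auto simp: P_def Q_def U_def Fl_def)
    have "r = ?D \<Longrightarrow> F (?D - 1) ?D \<noteq> 0" using nQ by simp
    from flag_exchange[OF R F _ this]
    obtain G where G: "G \<noteq> F r"
      "\<And>g. flag R ?D (F(r := g)) \<and> 0 < (F(r := g)) ?D ?D \<longleftrightarrow> g = F r \<or> g = G"
      by auto
    have inPQ: "(F(r := g), r) \<in> P - Q \<longleftrightarrow> g = F r \<or> g = G" for g
    proof -
      have "alternating True (lb (F(r := g))) ({..?D} - {r})"
        using alt alternating_cong[of "{..?D} - {r}" "lb (F(r := g))" "lb F"] by (simp add: lb_def)
      moreover have "(F(r := g), r) \<notin> Q" using nQ by (auto simp: Q_def)
      ultimately show ?thesis using G(2)[of g] F(3) by (simp add: P_def U_def Fl_def)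
    qed
    have "{y \<in> P - Q. (case y of (F, r) \<Rightarrow> (r, F(r := (\<lambda>_. 0)))) =
          (case x of (F, r) \<Rightarrow> (r, F(r := (\<lambda>_. 0))))} = {(F, r), (F(r := G), r)}"
      (is "?L = ?R")
    proof (rule set_eqI)
      fix y :: "(nat \<Rightarrow> nat \<Rightarrow> int) \<times> nat"
      obtain F' r' where y: "y = (F', r')" by fastforce
      have "y \<in> ?L \<longleftrightarrow> y \<in> P - Q \<and> r' = r \<and> F'(r := (\<lambda>_. 0)) = F(r := (\<lambda>_. 0))"
        by (auto simp: y Fr)
      also have "\<dots> \<longleftrightarrow> y \<in> P - Q \<and> r' = r \<and> F' = F(r := F' r)"
        by (auto simp: fun_eq_iff split: if_splits)
      also have "\<dots> \<longleftrightarrow> r' = r \<and> F' = F(r := F' r) \<and> (F' r = F r \<or> F' r = G)"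
        using inPQ[of "F' r"] unfolding y by metis
      also have "\<dots> \<longleftrightarrow> y \<in> ?R" by (auto simp: y)
      finally show "y \<in> ?L \<longleftrightarrow> y \<in> ?R" .
    qed
    moreover have "F \<noteq> F(r := G)" using G(1) by (metis fun_upd_same)
    ultimately show "card ?L = 2" by simp
  qed (use finP in simp)
  \<comment> \<open>The facets on the equator are the flags of the sphere of dimension \<open>d\<close>.\<close>
  have card_Q: "card Q = card {F. flag R d F \<and> alternating True (\<lambda>r. lab (F r)) {..d}}"
  proof (rule bij_betw_same_card[OF bij_betwI])
    let ?f = "\<lambda>(F, r :: nat). F(?D := (\<lambda>_. 0 :: int))"
    let ?g = "\<lambda>F. (F(?D := (F d)(?D := 1)), ?D)"
    have cut: "flag R d (F(?D := (\<lambda>_. 0))) \<and> F ?D = (F d)(?D := 1)"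
      if "flag R ?D F" "0 < F ?D ?D" "F d ?D = 0" for F
      using top_face_over_equator[OF R, of d "F ?D" "F d"] that unfolding flag_def by auto
    have Ds: "{..?D} - {?D} = {..d}" by auto
    have alt: "alternating True (lb (F(?D := g))) {..d} \<longleftrightarrow> alternating True (lb F) {..d}" for F g
      by (rule alternating_cong) (simp add: lb_def)
    have Q_iff: "(F, r) \<in> Q \<longleftrightarrow> r = ?D \<and> flag R ?D F \<and> 0 < F ?D ?D \<and> F d ?D = 0 \<and>
        alternating True (lb F) {..d}" for F r
    proof (cases "r = ?D")
      case True
      show ?thesis unfolding Q_def P_def U_def Fl_def mem_Collect_eq prod.case True Ds by blast
    next
      case False
      then show ?thesis by (simp add: Q_def)
    qed
    have lb_eq: "alternating True (\<lambda>r. lab (F r)) {..d} = alternating True (lb F) {..d}" for F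
      by (simp add: lb_def)
    show "?f \<in> Q \<rightarrow> {F. flag R d F \<and> alternating True (\<lambda>r. lab (F r)) {..d}}"
    proof
      fix x assume "x \<in> Q"
      then obtain F where F: "x = (F, ?D)" "flag R ?D F" "0 < F ?D ?D" "F d ?D = 0"
        "alternating True (lb F) {..d}"
        using Q_iff by (cases x) blast
      have "?f x = F(?D := (\<lambda>_. 0))" using F(1) by simp
      then show "?f x \<in> {F. flag R d F \<and> alternating True (\<lambda>r. lab (F r)) {..d}}"
        unfolding lb_eq using cut[OF F(2-4)] F(5) alt by simp
    qed
    show "?g \<in> {F. flag R d F \<and> alternating True (\<lambda>r. lab (F r)) {..d}} \<rightarrow> Q"
    proof
      fix F assume "F \<in> {F. flag R d F \<and> alternating True (\<lambda>r. lab (F r)) {..d}}"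
      then have F: "flag R d F" and a: "alternating True (lb F) {..d}" by (auto simp: lb_def)
      have "F d ?D = 0" using F by (auto simp: flag_def top_face_def)
      moreover have "flag R ?D (F(?D := (F d)(?D := 1)))"
        using F top_face_lift[OF R(2), of d "F d"] by (auto simp: flag_def less_Suc_eq)
      ultimately show "?g F \<in> Q" unfolding Q_iff using a alt by simp
    qed
    show "?g (?f x) = x" if x: "x \<in> Q" for x
    proof -
      obtain F where F: "x = (F, ?D)" "flag R ?D F" "0 < F ?D ?D" "F d ?D = 0"
        using x Q_iff by (cases x) blast
      then have "F(?D := (F d)(?D := 1)) = F"
        using cut[OF F(2-4)] by (metis fun_upd_triv)
      then show ?thesis using F(1) by simp
    qed
    show "?f (?g F) = F" if F: "F \<in> {F. flag R d F \<and> alternating True (\<lambda>r. lab (F r)) {..d}}" for F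
    proof -
      have "F ?D = (\<lambda>_. 0)" using F by (simp add: flag_def)
      then have "F(?D := (\<lambda>_. 0)) = F" by (metis fun_upd_triv)
      then show ?thesis by simp
    qed
  qed
  have mono: "on_sphere R ?D x" if "on_sphere R d x" for x
    using that by (auto simp: on_sphere_def intro: le_SucI)
  have "odd (card Q)" unfolding card_Q
    by (rule Suc.IH) (use Suc.prems mono in auto)
  moreover have "card P = card Q + card (P - Q)"
    using finP QP by (metis card_Diff_subset card_mono finite_subset le_add_diff_inverse)
  ultimately have "odd (card P)" using even_PQ by simp
  then show ?case using P_A by (simp add: A_def Fl_def lb_def)
qed

section \<open>The genus of the boundary of a cube\<close>

definition odd_map_dims :: "'a::real_normed_vector set \<Rightarrow> nat set" where
  "odd_map_dims A = {h. \<exists>\<phi> :: 'a \<Rightarrow> nat \<Rightarrow> real.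
     continuous_map (top_of_set A) (Euclidean_space h) \<phi> \<and>
     (\<forall>x\<in>A. \<phi> x \<noteq> (\<lambda>i. 0)) \<and> (\<forall>x\<in>A. \<phi> (- x) = (\<lambda>i. - \<phi> x i))}"

lemma genus_eq_INF: "A \<noteq> {} \<Longrightarrow> genus A = (INF h\<in>odd_map_dims A. enat h)"
  by (simp only: genus_def odd_map_dims_def if_False)

text \<open>
  The unit sphere of the maximum norm in the coordinate subspace of \<open>U\<close>, that is, the boundary of
  a cube of dimension \<open>card U\<close>.
\<close>

definition coord_sphere :: "'v::finite set \<Rightarrow> (real ^ 'v) set" where
  "coord_sphere U = {a. (\<forall>v. v \<notin> U \<longrightarrow> a $ v = 0) \<and> (\<forall>v. \<bar>a $ v\<bar> \<le> 1) \<and> (\<exists>v. \<bar>a $ v\<bar> = 1)}"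

lemma uminus_coord_sphere: "- a \<in> coord_sphere U \<longleftrightarrow> a \<in> coord_sphere U"
  by (simp add: coord_sphere_def)

lemma norm_le_card_if_bounded:
  fixes a :: "real ^ 'v::finite"
  assumes "\<And>v. \<bar>a $ v\<bar> \<le> 1" shows "norm a \<le> real CARD('v)"
proof -
  have "norm a \<le> (\<Sum>v\<in>UNIV. \<bar>a $ v\<bar>)" by (rule norm_le_l1_cart)
  also have "\<dots> \<le> (\<Sum>v\<in>(UNIV :: 'v set). 1)" by (rule sum_mono) (rule assms)
  finally show ?thesis by simp
qed

lemma compact_coord_sphere: "compact (coord_sphere U)" for U :: "'v::finite set"
proof -
  have "closed {a :: real ^ 'v. v \<notin> U \<longrightarrow> a $ v = 0}" for v
    by (cases "v \<in> U") (auto intro!: closed_Collect_eq continuous_intros)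
  moreover have "closed {a :: real ^ 'v. \<bar>a $ v\<bar> \<le> 1}" for v
    by (intro closed_Collect_le continuous_intros)
  moreover have "closed {a :: real ^ 'v. \<bar>a $ v\<bar> = 1}" for v
    by (intro closed_Collect_eq continuous_intros)
  moreover have "coord_sphere U = (\<Inter>v. {a. v \<notin> U \<longrightarrow> a $ v = 0}) \<inter>
      (\<Inter>v. {a. \<bar>a $ v\<bar> \<le> 1}) \<inter> (\<Union>v. {a. \<bar>a $ v\<bar> = 1})"
    by (auto simp: coord_sphere_def)
  ultimately have "closed (coord_sphere U)"
    by (simp add: closed_INT closed_Int closed_UN)
  moreover have "norm a \<le> real CARD('v)" if "a \<in> coord_sphere U" for a :: "real ^ 'v"
    by (rule norm_le_card_if_bounded) (use that in \<open>simp add: coord_sphere_def\<close>)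
  then have "bounded (coord_sphere U)" unfolding bounded_iff by blast
  ultimately show ?thesis by (simp add: compact_eq_bounded_closed)
qed

text \<open>
  The Borsuk-Ulam theorem. Given an odd map \<open>\<phi>\<close> without zeros into dimension \<open>h\<close>, label each
  grid point of the boundary of the cube by the index of the first component of \<open>\<phi>\<close> that is at
  least \<open>\<epsilon>\<close> in absolute value, counted from 1, with the sign of this component. For a suitable
  \<open>\<epsilon>\<close> there always is one by compactness, and for a fine grid a component cannot change by \<open>2 \<epsilon>\<close>
  between adjacent points, so adjacent labels are not opposite. Ky Fan's lemma then gives a
  simplex whose \<open>card U\<close> labels have different absolute values, all between 1 and \<open>h\<close>.
\<close>

lemma genus_coord_sphere: "enat (card U) \<le> genus (coord_sphere U)" for U :: "'v::finite set"
proof (cases "U = {}")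
  case True
  then show ?thesis by (simp add: zero_enat_def[symmetric])
next
  case False
  define d where "d = card U - 1"
  have cU: "card U = Suc d" using False by (simp add: d_def card_gt_0_iff)
  obtain idx where idx: "bij_betw idx U {..d}"
    using finite_same_card_bij[of U "{..d}"] cU by auto
  let ?T = "coord_sphere U"
  obtain u where u: "u \<in> U" using False by blast
  have "axis u 1 \<in> ?T" using u by (auto simp: coord_sphere_def axis_def)
  then have T: "?T \<noteq> {}" by blast
  have "Suc d \<le> h"
    if cont: "continuous_map (top_of_set ?T) (Euclidean_space h) \<phi>"
      and nz: "\<And>x. x \<in> ?T \<Longrightarrow> \<phi> x \<noteq> (\<lambda>i. 0)"
      and odd: "\<And>x. x \<in> ?T \<Longrightarrow> \<phi> (- x) = (\<lambda>i. - \<phi> x i)"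
    for h and \<phi> :: "real ^ 'v \<Rightarrow> nat \<Rightarrow> real"
  proof -
    have c: "continuous_on ?T (\<lambda>x. \<phi> x i)" for i
    proof -
      have "continuous_map (top_of_set ?T) (powertop_real UNIV) \<phi>"
        using cont unfolding Euclidean_space_def continuous_map_in_subtopology by blast
      then show ?thesis
        by (simp add: continuous_map_componentwise_UNIV)
    qed
    have z: "\<phi> x i = 0" if "x \<in> ?T" "i \<ge> h" for x i
    proof -
      have "\<phi> x \<in> topspace (Euclidean_space h)"
        using cont that(1) unfolding continuous_map_def by auto
      then show ?thesis using that(2) by (simp add: topspace_Euclidean_space)
    qed
    have "continuous_on ?T (\<lambda>x. \<Sum>i<h. \<bar>\<phi> x i\<bar>)"
      by (intro continuous_intros c)
    then obtain x0 where x0: "x0 \<in> ?T"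
      "\<And>x. x \<in> ?T \<Longrightarrow> (\<Sum>i<h. \<bar>\<phi> x0 i\<bar>) \<le> (\<Sum>i<h. \<bar>\<phi> x i\<bar>)"
      using continuous_attains_inf[OF compact_coord_sphere T] by blast
    define \<epsilon> where "\<epsilon> = (\<Sum>i<h. \<bar>\<phi> x0 i\<bar>) / (real h + 1)"
    obtain i0 where i0: "\<phi> x0 i0 \<noteq> 0" using nz[OF x0(1)] by auto
    then have "i0 < h" using z[OF x0(1)] not_le by blast
    then have "0 < (\<Sum>i<h. \<bar>\<phi> x0 i\<bar>)"
      using i0 by (intro sum_pos2[of _ i0]) auto
    then have \<epsilon>: "0 < \<epsilon>" by (simp add: \<epsilon>_def)
    have large: "\<exists>i<h. \<epsilon> \<le> \<bar>\<phi> x i\<bar>" if "x \<in> ?T" for x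
    proof (rule ccontr)
      assume "\<not> ?thesis"
      then have "(\<Sum>i<h. \<bar>\<phi> x i\<bar>) \<le> (\<Sum>i<h. \<epsilon>)"
        by (intro sum_mono) (auto intro: less_imp_le simp: not_le)
      also have "\<dots> < (real h + 1) * \<epsilon>" using \<epsilon> by (simp add: algebra_simps)
      also have "\<dots> = (\<Sum>i<h. \<bar>\<phi> x0 i\<bar>)" by (simp add: \<epsilon>_def)
      finally show False using x0(2)[OF that] by simp
    qed
    have "\<exists>\<delta>>0. \<forall>i<n. \<forall>x\<in>?T. \<forall>y\<in>?T. dist x y < \<delta> \<longrightarrow> \<bar>\<phi> x i - \<phi> y i\<bar> < \<epsilon>" for n
    proof (induction n)
      case (Suc n)
      then obtain \<delta>1 where \<delta>1: "\<delta>1 > 0"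
        "\<forall>i<n. \<forall>x\<in>?T. \<forall>y\<in>?T. dist x y < \<delta>1 \<longrightarrow> \<bar>\<phi> x i - \<phi> y i\<bar> < \<epsilon>" by blast
      have "uniformly_continuous_on ?T (\<lambda>x. \<phi> x n)"
        by (intro compact_uniformly_continuous c compact_coord_sphere)
      then obtain \<delta>2 where \<delta>2: "\<delta>2 > 0"
        "\<forall>x\<in>?T. \<forall>y\<in>?T. dist y x < \<delta>2 \<longrightarrow> dist (\<phi> y n) (\<phi> x n) < \<epsilon>"
        unfolding uniformly_continuous_on_def using \<epsilon> by blast
      show ?case
      proof (intro exI[of _ "min \<delta>1 \<delta>2"] conjI allI impI ballI)
        fix i x y assume "i < Suc n" "x \<in> ?T" "y \<in> ?T" "dist x y < min \<delta>1 \<delta>2"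
        then show "\<bar>\<phi> x i - \<phi> y i\<bar> < \<epsilon>"
          using \<delta>1(2) \<delta>2(2) by (cases "i = n") (auto simp: dist_real_def)
      qed (use \<delta>1(1) \<delta>2(1) in simp)
    qed (auto intro: exI[of _ 1])
    then obtain \<delta> where \<delta>: "\<delta> > 0"
      "\<And>i x y. i < h \<Longrightarrow> x \<in> ?T \<Longrightarrow> y \<in> ?T \<Longrightarrow> dist x y < \<delta> \<Longrightarrow> \<bar>\<phi> x i - \<phi> y i\<bar> < \<epsilon>"
      by metis
    obtain N where N: "real N > real CARD('v) / \<delta>" using reals_Archimedean2 by blast
    define R :: int where "R = 2 * (int N + 1)"
    have R: "even R" "2 \<le> R" by (auto simp: R_def)
    have "real CARD('v) < \<delta> * real N" using N \<delta>(1) by (simp add: field_simps)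
    also have "\<dots> \<le> \<delta> * real_of_int R" using \<delta>(1) by (intro mult_left_mono) (auto simp: R_def)
    finally have R\<delta>: "real CARD('v) / real_of_int R < \<delta>" using R(2) by (simp add: field_simps)
    define pt :: "(nat \<Rightarrow> int) \<Rightarrow> real ^ 'v" where
      "pt = (\<lambda>x. \<chi> v. if v \<in> U then real_of_int (x (idx v)) / real_of_int R else 0)"
    have pt_T: "pt x \<in> ?T" if x: "on_sphere R d x" for x
    proof -
      obtain i where i: "i \<le> d" "\<bar>x i\<bar> = R" using x by (auto simp: on_sphere_def)
      obtain v where v: "v \<in> U" "idx v = i"
        using idx i(1) by (metis atMost_iff bij_betw_iff_bijections)
      have "\<bar>real_of_int (x (idx v))\<bar> \<le> real_of_int R" for v
        using x by (simp add: on_sphere_def flip: of_int_abs)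
      then have "\<bar>pt x $ v\<bar> \<le> 1" for v using R(2) by (simp add: pt_def)
      moreover have "\<bar>real_of_int (x (idx v))\<bar> = real_of_int R"
        using v i by (simp flip: of_int_abs)
      then have "\<bar>pt x $ v\<bar> = 1" using v(1) R(2) by (simp add: pt_def)
      moreover have "pt x $ w = 0" if "w \<notin> U" for w using that by (simp add: pt_def)
      ultimately show ?thesis unfolding coord_sphere_def by blast
    qed
    have pt_neg: "pt (- x) = - pt x" for x by (simp add: pt_def vec_eq_iff)
    have pt_near: "dist (pt x) (pt y) < \<delta>" if "\<And>i. \<bar>x i - y i\<bar> \<le> 1" for x y
    proof -
      have "dist (pt x) (pt y) \<le> (\<Sum>v\<in>UNIV. \<bar>(pt x - pt y) $ v\<bar>)"
        unfolding dist_norm by (rule norm_le_l1_cart)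
      also have "\<dots> \<le> (\<Sum>v\<in>(UNIV::'v set). 1 / real_of_int R)"
      proof (rule sum_mono)
        fix v
        have "\<bar>real_of_int (x (idx v)) - real_of_int (y (idx v))\<bar> \<le> 1"
          using that[of "idx v"] by (simp flip: of_int_diff of_int_abs)
        then show "\<bar>(pt x - pt y) $ v\<bar> \<le> 1 / real_of_int R"
          using R(2) by (simp add: pt_def divide_right_mono flip: diff_divide_distrib)
      qed
      also have "\<dots> < \<delta>" using R\<delta> by simp
      finally show ?thesis .
    qed
    define big where "big = (\<lambda>a. LEAST i. i < h \<and> \<epsilon> \<le> \<bar>\<phi> a i\<bar>)"
    have big: "big a < h \<and> \<epsilon> \<le> \<bar>\<phi> a (big a)\<bar>" if "a \<in> ?T" for a
      unfolding big_def by (rule LeastI_ex) (use large[OF that] in blast)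
    define lab :: "(nat \<Rightarrow> int) \<Rightarrow> int" where
      "lab = (\<lambda>x. (if 0 < \<phi> (pt x) (big (pt x)) then 1 else - 1) * (int (big (pt x)) + 1))"
    have big_neg: "big (- a) = big a" if "a \<in> ?T" for a
      unfolding big_def odd[OF that] by simp
    have lab_abs: "\<bar>lab x\<bar> = int (big (pt x)) + 1" for x by (simp add: lab_def abs_mult)
    have "Suc d \<le> h"
    proof -
      have "odd (card {F. flag R d F \<and> alternating True (\<lambda>r. lab (F r)) {..d}})"
      proof (rule odd_card_alternating_flags[OF R])
        fix x assume "on_sphere R d x"
        from pt_T[OF this] have x: "pt x \<in> ?T" .
        have "\<phi> (pt x) (big (pt x)) \<noteq> 0" using big[OF x] \<epsilon> by auto
        then show "lab (- x) = - lab x"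
          using odd[OF x] big_neg[OF x] by (simp add: lab_def pt_neg)
      next
        fix x y assume "on_sphere R d x" "on_sphere R d y" and near: "\<And>i. \<bar>x i - y i\<bar> \<le> 1"
        from this(1,2)[THEN pt_T] have x: "pt x \<in> ?T" and y: "pt y \<in> ?T" by auto
        show "lab x \<noteq> - lab y"
        proof
          assume eq: "lab x = - lab y"
          then have same: "big (pt x) = big (pt y)" using lab_abs[of x] lab_abs[of y] by simp
          define i where "i = big (pt y)"
          have "(0 < \<phi> (pt x) i) \<noteq> (0 < \<phi> (pt y) i)"
            using eq same by (auto simp: lab_def i_def split: if_splits)
          moreover have "\<epsilon> \<le> \<bar>\<phi> (pt x) i\<bar>" "\<epsilon> \<le> \<bar>\<phi> (pt y) i\<bar>" "i < h"
            using big[OF x] big[OF y] same by (auto simp: i_def)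
          moreover have "\<bar>\<phi> (pt x) i - \<phi> (pt y) i\<bar> < \<epsilon>"
            using \<delta>(2)[OF _ x y pt_near[OF near]] \<open>i < h\<close> by blast
          ultimately show False using \<epsilon> by (auto simp: abs_if split: if_splits)
        qed
      qed
      from odd_card_imp_not_empty[OF this]
      obtain F where F: "flag R d F" "alternating True (\<lambda>r. lab (F r)) {..d}"
        by blast
      have "inj_on (\<lambda>r. \<bar>lab (F r)\<bar>) {..d}" using F(2) by (simp add: alternating_def)
      moreover have "(\<lambda>r. \<bar>lab (F r)\<bar>) ` {..d} \<subseteq> {1..int h}"
      proof
        fix m assume "m \<in> (\<lambda>r. \<bar>lab (F r)\<bar>) ` {..d}"
        then obtain r where r: "r \<le> d" "m = int (big (pt (F r))) + 1" by (auto simp: lab_abs)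
        have "big (pt (F r)) < h"
          using big[OF pt_T[OF flag_on_sphere[OF R(1) F(1) r(1)]]] by blast
        then show "m \<in> {1..int h}" using r(2) by auto
      qed
      ultimately have "card {..d} \<le> card {1..int h}" by (rule card_inj_on_le) simp
      then show ?thesis by simp
    qed
    then show ?thesis .
  qed
  then have "enat (card U) \<le> enat h" if "h \<in> odd_map_dims ?T" for h
    using that unfolding odd_map_dims_def cU enat_ord_simps by blast
  then show ?thesis unfolding genus_eq_INF[OF T] by (rule INF_greatest)
qed

lemma genus_mono_odd_map:
  assumes g: "continuous_on S g" "g ` S \<subseteq> A" "\<And>x. x \<in> S \<Longrightarrow> g (- x) = - g x"
  shows "genus S \<le> genus A"
proof (cases "S = {}")
  case True
  then show ?thesis by (simp add: genus_def)
next
  case False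
  then have A: "A \<noteq> {}" using g(2) by blast
  have "odd_map_dims A \<subseteq> odd_map_dims S"
  proof
    fix h assume "h \<in> odd_map_dims A"
    then obtain \<phi> where \<phi>: "continuous_map (top_of_set A) (Euclidean_space h) \<phi>"
      "\<And>x. x \<in> A \<Longrightarrow> \<phi> x \<noteq> (\<lambda>i. 0)" "\<And>x. x \<in> A \<Longrightarrow> \<phi> (- x) = (\<lambda>i. - \<phi> x i)"
      unfolding odd_map_dims_def by blast
    have "continuous_map (top_of_set S) (top_of_set A) g"
      using g(1,2) by (simp add: image_subset_iff_funcset)
    then have "continuous_map (top_of_set S) (Euclidean_space h) (\<phi> \<circ> g)"
      using \<phi>(1) by (rule continuous_map_compose)
    moreover have "\<forall>x\<in>S. (\<phi> \<circ> g) x \<noteq> (\<lambda>i. 0)"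
      using \<phi>(2) g(2) by (simp add: image_subset_iff)
    moreover have "\<forall>x\<in>S. (\<phi> \<circ> g) (- x) = (\<lambda>i. - (\<phi> \<circ> g) x i)"
      using \<phi>(3) g(2,3) by (simp add: image_subset_iff)
    ultimately show "h \<in> odd_map_dims S" unfolding odd_map_dims_def by blast
  qed
  then show ?thesis
    unfolding genus_eq_INF[OF A] genus_eq_INF[OF False] by (rule INF_superset_mono) simp
qed

section \<open>Tent functions\<close>

text \<open>
  Paths described by their length only, built up edge by edge: the form in which concatenation
  and reversal are easy.
\<close>

inductive walk :: "('v \<times> 'v) set \<Rightarrow> ('v \<Rightarrow> 'v \<Rightarrow> real) \<Rightarrow> 'v \<Rightarrow> 'v \<Rightarrow> real \<Rightarrow> bool"
  for E w u where
  nil: "walk E w u u 0"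
| step: "walk E w u v l \<Longrightarrow> (v, x) \<in> E \<Longrightarrow> walk E w u x (l + inverse (w v x))"

lemma path_length_snoc:
  assumes "vs \<noteq> []"
  shows "path_length w (vs @ [x]) = path_length w vs + inverse (w (last vs) x)"
proof -
  have "(\<Sum>i = 1..<length vs. inverse (w ((vs @ [x]) ! (i - 1)) ((vs @ [x]) ! i))) =
      (\<Sum>i = 1..<length vs. inverse (w (vs ! (i - 1)) (vs ! i)))"
    by (rule sum.cong) (auto simp: nth_append)
  moreover have "{1..<length (vs @ [x])} = insert (length vs) {1..<length vs}"
    using assms by (auto simp: Suc_le_eq)
  ultimately show ?thesis
    using assms by (simp add: path_length_def nth_append last_conv_nth)
qed

lemma walk_iff_path:
  "walk E w u v l \<longleftrightarrow> (\<exists>vs. path_between E u v vs \<and> path_length w vs = l)"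
proof
  assume "walk E w u v l"
  then show "\<exists>vs. path_between E u v vs \<and> path_length w vs = l"
  proof induction
    case nil
    then show ?case by (intro exI[of _ "[u]"]) (simp add: path_between_def path_length_def)
  next
    case (step v l x)
    then obtain vs where vs: "path_between E u v vs" "path_length w vs = l" by blast
    then show ?case
      using step.hyps(2)
      by (intro exI[of _ "vs @ [x]"])
        (auto simp: path_between_def path_length_snoc successively_append_iff)
  qed
next
  assume "\<exists>vs. path_between E u v vs \<and> path_length w vs = l"
  then obtain vs where "path_between E u v vs" "path_length w vs = l" by blast
  then show "walk E w u v l"
  proof (induction vs arbitrary: v l rule: rev_induct)
    case (snoc x vs)
    show ?case
    proof (cases "vs = []")
      case True
      then have "l = 0" "u = v"
        using snoc.prems by (auto simp: path_between_def path_length_def)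
      then show ?thesis by (simp add: walk.nil)
    next
      case False
      then have "path_between E u (last vs) vs" "(last vs, v) \<in> E"
        "l = path_length w vs + inverse (w (last vs) v)"
        using snoc.prems path_length_snoc[OF False, of w x]
        by (auto simp: path_between_def successively_append_iff)
      then show ?thesis using snoc.IH walk.step by metis
    qed
  qed (simp add: path_between_def)
qed

lemma graph_dist_less_iff: "graph_dist E w u v < t \<longleftrightarrow> (\<exists>l. walk E w u v l \<and> ereal l < t)"
  unfolding graph_dist_def INF_less_iff walk_iff_path by auto

lemma walk_trans:
  assumes "walk E w v x m" "walk E w u v l"
  shows "walk E w u x (l + m)"
  using assms
proof induction
  case (step y m x)
  then show ?case using walk.step[of E w u y "l + m" x] by (simp add: add.assoc)
qed simp

text \<open>
  The positive part of \<open>r\<close> minus the distance to \<open>c\<close>. The distance is cut off at \<open>r\<close> first since it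
  can be infinite.
\<close>

definition tent :: "('v \<times> 'v) set \<Rightarrow> ('v \<Rightarrow> 'v \<Rightarrow> real) \<Rightarrow> real \<Rightarrow> 'v \<Rightarrow> 'v \<Rightarrow> real" where
  "tent E w r c x = r - real_of_ereal (min (ereal r) (graph_dist E w c x))"

definition tent_combination ::
    "('v::finite \<times> 'v) set \<Rightarrow> ('v \<Rightarrow> 'v \<Rightarrow> real) \<Rightarrow> real \<Rightarrow> 'v set \<Rightarrow> real ^ 'v \<Rightarrow> real ^ 'v" where
  "tent_combination E w r U a = (\<chi> x. \<Sum>c\<in>U. a $ c * tent E w r c x)"

context weighted_graph_with_boundary
begin

lemma walk_edge: "(v, x) \<in> E \<Longrightarrow> walk E w v x (inverse (w v x))"
  using walk.step[OF walk.nil] by fastforce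

lemma walk_nonneg: "walk E w u v l \<Longrightarrow> 0 \<le> l"
proof (induction rule: walk.induct)
  case (step v l x)
  then show ?case using weight_pos[OF step.hyps(2)] by simp
qed simp

lemma walk_sym: "walk E w u v l \<Longrightarrow> walk E w v u l"
proof (induction rule: walk.induct)
  case (step v l x)
  have "(x, v) \<in> E" using sym_edges step.hyps(2) by (rule symD)
  then have "walk E w x v (inverse (w v x))"
    using walk_edge[of x v] weight_sym[OF step.hyps(2)] by simp
  then show ?case using walk_trans[OF step.IH, of x "inverse (w v x)"] by (simp add: add.commute)
qed (rule walk.nil)

lemma graph_dist_nonneg: "0 \<le> graph_dist E w u v"
proof (rule ccontr)
  assume "\<not> 0 \<le> graph_dist E w u v"
  then have "graph_dist E w u v < 0" by simp
  then obtain l where "walk E w u v l" "ereal l < 0" unfolding graph_dist_less_iff by blast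
  then show False using walk_nonneg by force
qed

lemma ereal_tent:
  assumes "0 < r" shows "min (ereal r) (graph_dist E w c x) = ereal (r - tent E w r c x)"
    and "0 \<le> tent E w r c x" "tent E w r c x \<le> r"
proof -
  let ?m = "min (ereal r) (graph_dist E w c x)"
  have "0 \<le> ?m" "?m \<le> ereal r" using graph_dist_nonneg assms by auto
  then obtain t where t: "?m = ereal t" by (cases ?m) auto
  then show "?m = ereal (r - tent E w r c x)" by (simp add: tent_def)
  have "0 \<le> t" "t \<le> r" using t \<open>0 \<le> ?m\<close> \<open>?m \<le> ereal r\<close> by auto
  then show "0 \<le> tent E w r c x" "tent E w r c x \<le> r" using t by (auto simp: tent_def)
qed

lemma tent_ge:
  assumes "0 < r" "walk E w c x l" shows "r - l \<le> tent E w r c x"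
proof -
  have "graph_dist E w c x \<le> ereal l"
    using assms(2) unfolding graph_dist_def walk_iff_path by (auto intro: INF_lower)
  then have "ereal (r - tent E w r c x) \<le> ereal l"
    unfolding ereal_tent(1)[OF assms(1), symmetric] by (rule min.coboundedI2)
  then show ?thesis by simp
qed

lemma tent_less_walk:
  assumes "0 < r" "0 \<le> t" "t < tent E w r c x"
  obtains l where "walk E w c x l" "l < r - t"
proof -
  have "min (ereal r) (graph_dist E w c x) < ereal (r - t)"
    unfolding ereal_tent(1)[OF assms(1)] using assms(3) by simp
  then have "graph_dist E w c x < ereal (r - t)"
    using assms(2) by (auto simp: min_less_iff_disj)
  then show thesis using that unfolding graph_dist_less_iff by auto
qed

lemma tent_centre: "0 < r \<Longrightarrow> tent E w r c c = r"
  using tent_ge[OF _ walk.nil, of r c] ereal_tent(3)[of r c c] by simp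

lemma tent_eq_0:
  assumes "0 < r" "ereal r \<le> graph_dist E w c x" shows "tent E w r c x = 0"
  using ereal_tent(1)[OF assms(1), of c x] assms(2) by (simp add: min_absorb1)

lemma tent_edge:
  assumes "0 < r" "(v, x) \<in> E"
  shows "\<bar>tent E w r c x - tent E w r c v\<bar> \<le> inverse (w v x)"
proof -
  have *: "tent E w r c v - inverse (w v x) \<le> tent E w r c x" if e: "(v, x) \<in> E" for v x
  proof (rule ccontr)
    assume "\<not> ?thesis"
    then have "tent E w r c x + inverse (w v x) < tent E w r c v" by simp
    moreover have "0 \<le> tent E w r c x + inverse (w v x)"
      using ereal_tent(2)[OF assms(1), of c x] weight_pos[OF e] by simp
    ultimately obtain l where l: "walk E w c v l" "l < r - (tent E w r c x + inverse (w v x))"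
      using tent_less_walk assms(1) by metis
    then show False using tent_ge[OF assms(1) walk.step[OF l(1) e]] by simp
  qed
  have "(x, v) \<in> E" using sym_edges assms(2) by (rule symD)
  then show ?thesis using *[OF assms(2)] *[of x v] weight_sym[OF assms(2)] by (simp add: abs_le_iff)
qed

text \<open>
  Otherwise the walks from \<open>c\<close> to \<open>v\<close>, from \<open>v\<close> to \<open>x\<close> and from \<open>x\<close> to \<open>c'\<close> would join the two
  centres in a length less than \<open>2 r\<close>. With \<open>m = 0\<close> this says that the supports are disjoint; for an
  edge it controls the slope between the supports of two different tents.
\<close>

lemma tents_separated:
  assumes r: "0 < r" and far: "ereal (2 * r) \<le> graph_dist E w c c'" and m: "walk E w v x m"
    and pos: "0 < tent E w r c v" "0 < tent E w r c' x"
  shows "tent E w r c v + tent E w r c' x \<le> m"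
proof (rule ccontr)
  let ?s = "tent E w r c v" and ?t = "tent E w r c' x"
  assume neg: "\<not> ?s + ?t \<le> m"
  \<comment> \<open>The slack is shared by the two walks; it must not exceed the values of the tents.\<close>
  define \<epsilon> where "\<epsilon> = min ((?s + ?t - m) / 2) (min ?s ?t)"
  have "\<epsilon> \<le> (?s + ?t - m) / 2" unfolding \<epsilon>_def by (rule min.cobounded1)
  then have \<epsilon>: "0 < \<epsilon>" "\<epsilon> \<le> ?s" "\<epsilon> \<le> ?t" "2 * \<epsilon> \<le> ?s + ?t - m"
    using neg pos by (auto simp: \<epsilon>_def)
  obtain l where l: "walk E w c v l" "l < r - (?s - \<epsilon>)"
    using tent_less_walk[OF r, of "?s - \<epsilon>" c v] \<epsilon> by auto
  obtain l' where l': "walk E w c' x l'" "l' < r - (?t - \<epsilon>)"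
    using tent_less_walk[OF r, of "?t - \<epsilon>" c' x] \<epsilon> by auto
  have "walk E w c c' (l + m + l')"
    using walk_trans[OF walk_sym[OF l'(1)] walk_trans[OF m l(1)]] .
  moreover have "l + m + l' < 2 * r" using l(2) l'(2) \<epsilon>(4) by simp
  ultimately have "graph_dist E w c c' < ereal (2 * r)"
    unfolding graph_dist_less_iff by auto
  then show False using far by simp
qed

text \<open>
  At every vertex at most one tent is nonzero. Along an edge, either one tent accounts for the
  values at both ends, and its slope is at most 1, or two different tents do, one at each end, and
  their values add up to at most the length of the edge.
\<close>

lemma tent_combination_bounds:
  assumes r: "0 < r" and U: "U \<noteq> {}"
    and far: "\<And>c c'. c \<in> U \<Longrightarrow> c' \<in> U \<Longrightarrow> c \<noteq> c' \<Longrightarrow> ereal (2 * r) \<le> graph_dist E w c c'"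
    and a: "\<And>c. \<bar>a $ c\<bar> \<le> 1"
  shows "c \<in> U \<Longrightarrow> tent_combination E w r U a $ c = r * a $ c"
    and "(v, x) \<in> E \<Longrightarrow> \<bar>gradient w (tent_combination E w r U a) v x\<bar> \<le> 1"
proof -
  have disjoint: "tent E w r c x = 0 \<or> tent E w r c' x = 0"
    if "c \<in> U" "c' \<in> U" "c \<noteq> c'" for c c' x
  proof (rule ccontr)
    assume "\<not> ?thesis"
    then have "0 < tent E w r c x" "0 < tent E w r c' x"
      using ereal_tent(2)[OF r] by (metis order_le_less)+
    then show False
      using tents_separated[OF r far[OF that] walk.nil] by fastforce
  qed
  have single: "tent_combination E w r U a $ x = a $ c * tent E w r c x"
    if "c \<in> U" "\<And>c'. c' \<in> U \<Longrightarrow> c' \<noteq> c \<Longrightarrow> tent E w r c' x = 0" for c x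
  proof -
    have "(\<Sum>c'\<in>U. a $ c' * tent E w r c' x) = (\<Sum>c'\<in>{c}. a $ c' * tent E w r c' x)"
      by (rule sum.mono_neutral_right) (use that in auto)
    then show ?thesis by (simp add: tent_combination_def)
  qed
  show "tent_combination E w r U a $ c = r * a $ c" if "c \<in> U"
    using single[of c c] disjoint[of _ c c] that tent_centre[OF r, of c] r by auto
  have active: "\<exists>c\<in>U. \<forall>c'\<in>U. c' \<noteq> c \<longrightarrow> tent E w r c' x = 0" for x
    using disjoint U by (metis all_not_in_conv)
  assume e: "(v, x) \<in> E"
  obtain c where c: "c \<in> U" "\<And>c'. c' \<in> U \<Longrightarrow> c' \<noteq> c \<Longrightarrow> tent E w r c' v = 0"
    using active by blast
  obtain d where d: "d \<in> U" "\<And>c'. c' \<in> U \<Longrightarrow> c' \<noteq> d \<Longrightarrow> tent E w r c' x = 0"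
    using active by blast
  have at_v: "tent_combination E w r U a $ v = a $ c * tent E w r c v"
    by (rule single) (use c in auto)
  have at_x: "tent_combination E w r U a $ x = a $ d * tent E w r d x"
    by (rule single) (use d in auto)
  have one: "\<bar>a $ b * tent E w r b x - a $ b * tent E w r b v\<bar> \<le> inverse (w v x)" for b
  proof -
    have "\<bar>a $ b * tent E w r b x - a $ b * tent E w r b v\<bar> =
        \<bar>a $ b\<bar> * \<bar>tent E w r b x - tent E w r b v\<bar>"
      by (simp add: right_diff_distrib flip: abs_mult)
    also have "\<dots> \<le> 1 * inverse (w v x)"
      by (rule mult_mono) (use a tent_edge[OF r e] in auto)
    finally show ?thesis by simp
  qed
  have "\<bar>tent_combination E w r U a $ x - tent_combination E w r U a $ v\<bar> \<le> inverse (w v x)"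
  proof (cases "c \<noteq> d \<and> tent E w r c v \<noteq> 0 \<and> tent E w r d x \<noteq> 0")
    case True
    have "0 < tent E w r c v" "0 < tent E w r d x"
      using True ereal_tent(2)[OF r] by (metis order_le_less)+
    then have sum: "tent E w r c v + tent E w r d x \<le> inverse (w v x)"
      using tents_separated[OF r far[OF c(1) d(1)] walk_edge[OF e]] True by blast
    have b: "\<bar>a $ b * tent E w r b y\<bar> \<le> tent E w r b y" for b y
      using a[of b] ereal_tent(2)[OF r, of b y] by (simp add: abs_mult mult_left_le_one_le)
    show ?thesis
      unfolding at_v at_x
      using b[of d x] b[of c v] sum abs_triangle_ineq4[of "a $ d * tent E w r d x" "a $ c * tent E w r c v"]
      by linarith
  next
    case False
    then consider "c = d" | "c \<noteq> d" "tent E w r c v = 0" | "c \<noteq> d" "tent E w r d x = 0" by blast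
    then obtain b where "tent_combination E w r U a $ x = a $ b * tent E w r b x"
      "tent_combination E w r U a $ v = a $ b * tent E w r b v"
    proof cases
      case 1
      show ?thesis by (rule that[of c]) (use at_v at_x 1 in simp_all)
    next
      case 2
      then have "tent E w r d v = 0" using c(2) d(1) by blast
      then show ?thesis by (intro that[of d]) (use at_v at_x 2 in simp_all)
    next
      case 3
      then have "tent E w r c x = 0" using d(2) c(1) by blast
      then show ?thesis by (intro that[of c]) (use at_v at_x 3 in simp_all)
    qed
    then show ?thesis using one[of b] by simp
  qed
  then have "w v x * \<bar>tent_combination E w r U a $ x - tent_combination E w r U a $ v\<bar> \<le>
      w v x * inverse (w v x)"
    using weight_pos[OF e] by (intro mult_left_mono) auto
  then show "\<bar>gradient w (tent_combination E w r U a) v x\<bar> \<le> 1"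
    using weight_pos[OF e] by (simp add: gradient_def abs_mult)
qed

text \<open>
  Distinct vertices are at least as far apart as the shortest edge is long, so half of this length
  is admissible for any choice of \<open>k\<close> internal nodes. The number 1 is added so that the minimum
  exists if there are no edges.
\<close>

lemma packing_set_nonempty:
  assumes "k \<le> card (- B)" shows "packing_set E w B k \<noteq> {}"
proof -
  define \<delta> where "\<delta> = Min (insert 1 ((\<lambda>(u, v). inverse (w u v)) ` E))"
  have \<delta>: "0 < \<delta>" unfolding \<delta>_def by (subst Min_gr_iff) (use weight_pos in auto)
  have edge: "\<delta> \<le> inverse (w u v)" if "(u, v) \<in> E" for u v
    unfolding \<delta>_def by (rule Min_le) (use that in force)+
  have walk: "u = v \<or> \<delta> \<le> l" if "walk E w u v l" for u v l
    using that
  proof induction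
    case (step v l x)
    then show ?case using walk_nonneg[OF step.hyps(1)] edge[OF step.hyps(2)] by linarith
  qed simp
  have dist: "ereal \<delta> \<le> graph_dist E w u v" if "u \<noteq> v" for u v
  proof (rule ccontr)
    assume "\<not> ?thesis"
    then obtain l where "walk E w u v l" "ereal l < ereal \<delta>"
      unfolding not_le graph_dist_less_iff by blast
    then show False using walk that by force
  qed
  obtain U where U: "U \<subseteq> - B" "card U = k" using assms obtain_subset_with_card_n by metis
  then obtain u where u: "bij_betw u {1..k} U"
    using finite_same_card_bij[of "{1..k}" U] by auto
  have "ereal (\<delta> / 2) \<le> ereal \<delta>" using \<delta> by simp
  then have bd: "ereal (\<delta> / 2) \<le> boundary_dist E w B (u i)" if "i \<in> {1..k}" for i
  proof -
    have "u i \<notin> B" using bij_betwE[OF u] U(1) that by blast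
    then show ?thesis
      unfolding boundary_dist_def
      by (intro INF_greatest order_trans[OF \<open>ereal (\<delta> / 2) \<le> ereal \<delta>\<close>] dist) auto
  qed
  have "\<delta> / 2 \<in> packing_set E w B k"
    unfolding packing_set_def mem_Collect_eq
  proof (intro conjI exI[of _ u] ballI impI)
    fix i j assume ij: "i \<in> {1..k}" "j \<in> {1..k}" "i \<noteq> j"
    then have "u i \<noteq> u j" using inj_onD[OF bij_betw_imp_inj_on[OF u]] by blast
    from dist[OF this] show "ereal (2 * (\<delta> / 2)) \<le> graph_dist E w (u i) (u j)" by simp
  next
    fix i assume "i \<in> {1..k}" then show "u i \<in> - B" using bij_betwE[OF u] U(1) by blast
  next
    fix i assume "i \<in> {1..k}" then show "ereal (\<delta> / 2) \<le> boundary_dist E w B (u i)" by (rule bd)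
  qed (use \<delta> in simp)
  then show ?thesis by blast
qed

end

section \<open>The limit of the Rayleigh quotients\<close>

text \<open>
  The gradient is 0 if there are no edges; otherwise the inserted 0 does not change the maximum.
\<close>

definition sup_gradient :: "('v::finite \<times> 'v) set \<Rightarrow> ('v \<Rightarrow> 'v \<Rightarrow> real) \<Rightarrow> real ^ 'v \<Rightarrow> real" where
  "sup_gradient E w f = Max (insert 0 ((\<lambda>(u, v). \<bar>gradient w f u v\<bar>) ` E))"

definition sup_norm :: "real ^ 'v::finite \<Rightarrow> real" where
  "sup_norm f = Max (range (\<lambda>u. \<bar>f $ u\<bar>))"

definition sup_rayleigh :: "('v::finite \<times> 'v) set \<Rightarrow> ('v \<Rightarrow> 'v \<Rightarrow> real) \<Rightarrow> real ^ 'v \<Rightarrow> real" where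
  "sup_rayleigh E w f = sup_gradient E w f / sup_norm f"

lemma sup_norm_upper: "\<bar>f $ u\<bar> \<le> sup_norm f" for f :: "real ^ 'v::finite"
  unfolding sup_norm_def by (rule Max_ge) auto

lemma sup_norm_attained: "\<exists>u. sup_norm f = \<bar>f $ u\<bar>" for f :: "real ^ 'v::finite"
proof -
  have "sup_norm f \<in> range (\<lambda>u. \<bar>f $ u\<bar>)" unfolding sup_norm_def by (rule Max_in) auto
  then show ?thesis by blast
qed

lemma sup_norm_nonneg: "0 \<le> sup_norm f" for f :: "real ^ 'v::finite"
  using sup_norm_attained[of f] by auto

lemma sup_norm_pos: "f \<noteq> 0 \<Longrightarrow> 0 < sup_norm f" for f :: "real ^ 'v::finite"
proof -
  assume "f \<noteq> 0"
  then obtain u where "f $ u \<noteq> 0" by (auto simp: vec_eq_iff)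
  then show ?thesis using sup_norm_upper[of f u] by linarith
qed

lemma sup_gradient_nonneg: "0 \<le> sup_gradient E w f"
  unfolding sup_gradient_def by (rule Max_ge) auto

lemma sup_gradient_upper: "(u, v) \<in> E \<Longrightarrow> \<bar>gradient w f u v\<bar> \<le> sup_gradient E w f"
  unfolding sup_gradient_def by (rule Max_ge) force+

lemma sup_gradient_attained:
  "sup_gradient E w f = 0 \<or> (\<exists>(u, v)\<in>E. sup_gradient E w f = \<bar>gradient w f u v\<bar>)"
proof -
  have "sup_gradient E w f \<in> insert 0 ((\<lambda>(u, v). \<bar>gradient w f u v\<bar>) ` E)"
    unfolding sup_gradient_def by (rule Max_in) auto
  then show ?thesis by auto
qed

lemma sup_gradient_leI:
  "0 \<le> t \<Longrightarrow> (\<And>u v. (u, v) \<in> E \<Longrightarrow> \<bar>gradient w f u v\<bar> \<le> t) \<Longrightarrow> sup_gradient E w f \<le> t"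
  using sup_gradient_attained[of E w f] by auto

lemma sup_rayleigh_nonneg: "0 \<le> sup_rayleigh E w f"
  by (simp add: sup_rayleigh_def sup_gradient_nonneg sup_norm_nonneg)

lemma sup_rayleigh_scaleR:
  assumes "0 < c" shows "sup_rayleigh E w (c *\<^sub>R f) = sup_rayleigh E w f"
proof -
  have le: "sup_norm (c *\<^sub>R f) \<le> c * sup_norm f" "sup_gradient E w (c *\<^sub>R f) \<le> c * sup_gradient E w f"
    if "0 < c" for c and f :: "real ^ 'a"
  proof -
    have "\<bar>(c *\<^sub>R f) $ u\<bar> = c * \<bar>f $ u\<bar>" for u using that by (simp add: abs_mult)
    then show "sup_norm (c *\<^sub>R f) \<le> c * sup_norm f"
      using sup_norm_attained[of "c *\<^sub>R f"] sup_norm_upper[of f] that by fastforce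
    show "sup_gradient E w (c *\<^sub>R f) \<le> c * sup_gradient E w f"
    proof (rule sup_gradient_leI)
      fix u v assume "(u, v) \<in> E"
      have "gradient w (c *\<^sub>R f) u v = c * gradient w f u v"
        by (simp add: gradient_def algebra_simps)
      then show "\<bar>gradient w (c *\<^sub>R f) u v\<bar> \<le> c * sup_gradient E w f"
        using sup_gradient_upper[OF \<open>(u, v) \<in> E\<close>, of w f] that by (simp add: abs_mult)
    qed (intro mult_nonneg_nonneg less_imp_le[OF that] sup_gradient_nonneg)
  qed
  have unscale: "f = inverse c *\<^sub>R (c *\<^sub>R f)" using assms by simp
  have "sup_norm (c *\<^sub>R f) = c * sup_norm f"
    using le(1)[OF assms, of f] le(1)[of "inverse c" "c *\<^sub>R f"] assms unscale
    by (simp add: field_simps)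
  moreover have "sup_gradient E w (c *\<^sub>R f) = c * sup_gradient E w f"
    using le(2)[OF assms, of f] le(2)[of "inverse c" "c *\<^sub>R f"] assms unscale
    by (simp add: field_simps)
  ultimately show ?thesis using assms by (simp add: sup_rayleigh_def)
qed

lemma sup_rayleigh_bounded: "\<exists>K. \<forall>f. sup_rayleigh E w f \<le> K"
proof (intro exI allI)
  fix f :: "real ^ 'a"
  let ?W = "\<Sum>(u, v)\<in>E. \<bar>w u v\<bar>"
  have W: "0 \<le> ?W" by (rule sum_nonneg) auto
  show "sup_rayleigh E w f \<le> 2 * ?W"
  proof (cases "sup_norm f = 0")
    case False
    then have pos: "0 < sup_norm f" using sup_norm_nonneg[of f] by simp
    have "sup_gradient E w f \<le> 2 * ?W * sup_norm f"
    proof (rule sup_gradient_leI)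
      fix u v assume e: "(u, v) \<in> E"
      have "\<bar>w u v\<bar> \<le> ?W"
        using member_le_sum[OF e, of "\<lambda>(u, v). \<bar>w u v\<bar>"] by auto
      moreover have "\<bar>f $ v - f $ u\<bar> \<le> 2 * sup_norm f"
        using sup_norm_upper[of f u] sup_norm_upper[of f v] by linarith
      ultimately have "\<bar>w u v\<bar> * \<bar>f $ v - f $ u\<bar> \<le> ?W * (2 * sup_norm f)"
        by (intro mult_mono W) auto
      then show "\<bar>gradient w f u v\<bar> \<le> 2 * ?W * sup_norm f"
        by (simp add: gradient_def abs_mult mult_ac)
    qed (use W pos in simp)
    then show ?thesis using pos by (simp add: sup_rayleigh_def field_simps)
  qed (use W in \<open>simp add: sup_rayleigh_def\<close>)
qed

lemma sum_powr_pos: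
  fixes f :: "real ^ 'v::finite"
  assumes "f \<noteq> 0" shows "0 < (\<Sum>u\<in>UNIV. \<bar>f $ u\<bar> powr p)"
proof -
  obtain u where "f $ u \<noteq> 0" using assms by (auto simp: vec_eq_iff)
  then show ?thesis by (intro sum_pos2[of _ u]) auto
qed

lemma vertex_pnorm_pos: "f \<noteq> 0 \<Longrightarrow> 0 < vertex_pnorm p f"
  unfolding vertex_pnorm_def using sum_powr_pos[of f p] by simp

lemma rayleigh_powr:
  assumes "0 < p"
  shows "rayleigh E w p f powr p =
    (1/2 * (\<Sum>(u, v)\<in>E. \<bar>gradient w f u v\<bar> powr p)) / (\<Sum>u\<in>UNIV. \<bar>f $ u\<bar> powr p)"
proof -
  have root: "(X powr (1/p) / Y powr (1/p)) powr p = X / Y" if "0 \<le> X" "0 \<le> Y" for X Y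
    using that assms by (simp add: powr_powr flip: powr_divide)
  show ?thesis
    unfolding rayleigh_def gradient_pnorm_def vertex_pnorm_def
    by (rule root) (auto intro!: sum_nonneg mult_nonneg_nonneg)
qed

text \<open>
  A sum of \<open>n\<close> powers lies between the largest one and \<open>n\<close> times the largest one. The summand 1
  keeps the upper constant positive if there are no edges.
\<close>

lemma rayleigh_powr_bounds:
  fixes f :: "real ^ 'v::finite"
  assumes p: "0 < p" and f: "f \<noteq> 0"
  shows "rayleigh E w p f powr p \<le> (real (card E) + 1) * sup_rayleigh E w f powr p" (is ?up)
    and "1 / (2 * real CARD('v)) * sup_rayleigh E w f powr p \<le> rayleigh E w p f powr p" (is ?low)
proof -
  let ?M = "sup_gradient E w f" and ?m = "sup_norm f"
  let ?G = "\<Sum>(u, v)\<in>E. \<bar>gradient w f u v\<bar> powr p" and ?S = "\<Sum>u\<in>UNIV. \<bar>f $ u\<bar> powr p"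
  have m: "0 < ?m" using f by (rule sup_norm_pos)
  have Q: "sup_rayleigh E w f powr p = ?M powr p / ?m powr p"
    using m by (simp add: sup_rayleigh_def powr_divide sup_gradient_nonneg)
  have S_low: "?m powr p \<le> ?S"
  proof -
    obtain u where "?m = \<bar>f $ u\<bar>" using sup_norm_attained by blast
    then show ?thesis using member_le_sum[of u UNIV "\<lambda>u. \<bar>f $ u\<bar> powr p"] by simp
  qed
  have "?S \<le> (\<Sum>u\<in>(UNIV::'v set). ?m powr p)"
    by (rule sum_mono) (use p sup_norm_upper in \<open>auto intro!: powr_mono2\<close>)
  then have S_up: "?S \<le> real CARD('v) * ?m powr p" by simp
  have "?G \<le> (\<Sum>(u, v)\<in>E. ?M powr p)"
    by (rule sum_mono) (use p sup_gradient_upper in \<open>auto intro!: powr_mono2\<close>)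
  then have G_up: "?G \<le> real (card E) * ?M powr p" by (simp add: case_prod_unfold)
  have G_nn: "0 \<le> ?G" by (rule sum_nonneg) auto
  have G_low: "?M powr p \<le> ?G"
    using sup_gradient_attained[of E w f]
  proof
    assume "\<exists>(u, v)\<in>E. ?M = \<bar>gradient w f u v\<bar>"
    then obtain u v where "(u, v) \<in> E" "?M = \<bar>gradient w f u v\<bar>" by blast
    then show ?thesis
      using member_le_sum[of "(u, v)" E "\<lambda>(u, v). \<bar>gradient w f u v\<bar> powr p"] by auto
  qed (use G_nn in simp)
  have mp: "0 < ?m powr p" using m by simp
  have "1/2 * ?G \<le> (real (card E) + 1) * ?M powr p"
    using G_up G_nn powr_ge_zero[of ?M p] unfolding distrib_right by linarith
  then have "1/2 * ?G / ?S \<le> (real (card E) + 1) * ?M powr p / ?m powr p"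
    by (intro frac_le S_low mp) auto
  then show ?up by (simp add: rayleigh_powr[OF p] Q)
  have "(1/2 * ?M powr p) / (real CARD('v) * ?m powr p) \<le> (1/2 * ?G) / ?S"
    using G_low G_nn sum_powr_pos[OF f, of p] by (intro frac_le S_up) auto
  then show ?low by (simp add: rayleigh_powr[OF p] Q)
qed

text \<open>
  A family that does not depend on \<open>p\<close>: it contains \<open>genus_family k (psphere B p)\<close> for every
  positive \<open>p\<close>, and each of its sets projects radially to a member of that family.
\<close>

definition punctured_family :: "'v::finite set \<Rightarrow> nat \<Rightarrow> (real ^ 'v) set set" where
  "punctured_family B k =
     {A. A \<subseteq> H0 B - {0} \<and> compact A \<and> uminus ` A = A \<and> enat k \<le> genus A}"

lemma nonempty_if_genus: "enat k \<le> genus A \<Longrightarrow> 1 \<le> k \<Longrightarrow> A \<noteq> {}"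
  by (auto simp: genus_def enat_0_iff)

lemma punctured_family_nonempty:
  assumes "A \<in> punctured_family B k" "1 \<le> k" shows "A \<noteq> {}"
  using assms(1) nonempty_if_genus[OF _ assms(2), of A] unfolding punctured_family_def by blast

lemma genus_family_punctured:
  fixes A :: "(real ^ 'v::finite) set"
  assumes p: "0 < p" and A: "A \<in> genus_family k (psphere B p)"
  shows "A \<in> punctured_family B k"
proof -
  have one: "f \<in> H0 B" "(\<Sum>u\<in>UNIV. \<bar>f $ u\<bar> powr p) powr (1 / p) = 1" if "f \<in> A" for f
    using A that by (auto simp: genus_family_def psphere_def vertex_pnorm_def)
  have le1: "\<bar>f $ u\<bar> \<le> 1" if "f \<in> A" for f u
  proof (rule ccontr)
    assume "\<not> ?thesis"
    then have "1 < \<bar>f $ u\<bar> powr p" using p by (simp add: gr_one_powr)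
    also have "\<dots> \<le> (\<Sum>u\<in>UNIV. \<bar>f $ u\<bar> powr p)" by (rule member_le_sum) auto
    finally have "1 < (\<Sum>u\<in>UNIV. \<bar>f $ u\<bar> powr p) powr (1 / p)" using p by (simp add: gr_one_powr)
    then show False using one(2)[OF that] by simp
  qed
  have "norm f \<le> real CARD('v)" if "f \<in> A" for f
    by (rule norm_le_card_if_bounded[OF le1[OF that]])
  then have "bounded A" unfolding bounded_iff by blast
  moreover have "0 \<notin> A" using one(2)[of 0] p by auto
  ultimately show ?thesis
    using A one(1) by (auto simp: punctured_family_def genus_family_def compact_eq_bounded_closed)
qed

text \<open>
  Dividing by the \<open>p\<close>-norm is odd and continuous, so it does not decrease the genus, and by
  homogeneity it does not change the values of \<open>sup_rayleigh\<close>.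
\<close>

lemma radial_projection:
  fixes A :: "(real ^ 'v::finite) set"
  assumes p: "0 < p" and A: "A \<in> punctured_family B k"
  shows "\<exists>A'\<in>genus_family k (psphere B p). sup_rayleigh E w ` A' = sup_rayleigh E w ` A"
proof -
  define \<pi> where "\<pi> = (\<lambda>f :: real ^ 'v. inverse (vertex_pnorm p f) *\<^sub>R f)"
  have A_H0: "A \<subseteq> H0 B" and nz: "\<And>f. f \<in> A \<Longrightarrow> f \<noteq> 0" and cpt: "compact A"
    and sym: "uminus ` A = A" and gen: "enat k \<le> genus A"
    using A by (auto simp: punctured_family_def)
  have pos: "0 < vertex_pnorm p f" if "f \<in> A" for f using vertex_pnorm_pos[OF nz[OF that]] .
  have "continuous_on A (\<lambda>f. \<Sum>u\<in>UNIV. \<bar>f $ u\<bar> powr p)"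
    by (intro continuous_on_sum continuous_on_powr' continuous_intros) (use p in auto)
  then have "continuous_on A (vertex_pnorm p)"
    unfolding vertex_pnorm_def
    by (rule continuous_on_powr) (use sum_powr_pos[OF nz] in \<open>auto simp: less_imp_neq[symmetric]\<close>)
  then have cont: "continuous_on A \<pi>"
    unfolding \<pi>_def using pos by (intro continuous_intros) (auto simp: less_imp_neq[symmetric])
  have neg: "\<pi> (- f) = - \<pi> f" for f by (simp add: \<pi>_def vertex_pnorm_def)
  have scale: "vertex_pnorm p (c *\<^sub>R f) = c * vertex_pnorm p f" if "0 \<le> c" for c and f :: "real ^ 'v"
    using that p
    by (simp add: vertex_pnorm_def abs_mult powr_mult sum_nonneg powr_powr flip: sum_distrib_left)
  have "\<pi> ` A \<in> genus_family k (psphere B p)"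
    unfolding genus_family_def mem_Collect_eq
  proof (intro conjI)
    show "\<pi> ` A \<subseteq> psphere B p"
    proof
      fix g assume "g \<in> \<pi> ` A"
      then obtain f where f: "f \<in> A" "g = \<pi> f" by blast
      have "f \<in> H0 B" using f(1) A_H0 by blast
      then have "g \<in> H0 B" using f(2) by (simp add: H0_def \<pi>_def)
      moreover have "vertex_pnorm p g = 1" using pos[OF f(1)] by (simp add: f(2) \<pi>_def scale)
      ultimately show "g \<in> psphere B p" by (simp add: psphere_def)
    qed
    show "closed (\<pi> ` A)"
      by (rule compact_imp_closed[OF compact_continuous_image[OF cont cpt]])
    have "uminus ` \<pi> ` A = \<pi> ` uminus ` A" by (simp add: image_image neg)
    then show "uminus ` \<pi> ` A = \<pi> ` A" using sym by simp
    have "genus A \<le> genus (\<pi> ` A)" by (rule genus_mono_odd_map[OF cont]) (auto simp: neg)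
    then show "enat k \<le> genus (\<pi> ` A)" using gen by (rule order_trans[rotated])
  qed
  moreover have "sup_rayleigh E w ` \<pi> ` A = sup_rayleigh E w ` A"
    unfolding image_image \<pi>_def
    by (rule image_cong[OF refl], rule sup_rayleigh_scaleR) (use pos in simp)
  ultimately show ?thesis by blast
qed

definition sup_eigenvalue ::
    "('v::finite \<times> 'v) set \<Rightarrow> ('v \<Rightarrow> 'v \<Rightarrow> real) \<Rightarrow> 'v set \<Rightarrow> nat \<Rightarrow> real" where
  "sup_eigenvalue E w B k = (INF A\<in>punctured_family B k. SUP f\<in>A. sup_rayleigh E w f)"

lemma sup_rayleigh_bdd_above: "bdd_above (sup_rayleigh E w ` A)"
  using sup_rayleigh_bounded[of E w] unfolding bdd_above_def by blast

lemma SUP_nonneg: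
  fixes g :: "'a \<Rightarrow> real"
  assumes "A \<noteq> {}" "bdd_above (g ` A)" "\<And>x. 0 \<le> g x" shows "0 \<le> (SUP x\<in>A. g x)"
proof -
  obtain x where "x \<in> A" using assms(1) by blast
  then show ?thesis using cSUP_upper[OF _ assms(2)] assms(3) order_trans by blast
qed

lemma SUP_sup_rayleigh_nonneg: "A \<noteq> {} \<Longrightarrow> 0 \<le> (SUP f\<in>A. sup_rayleigh E w f)"
  by (rule SUP_nonneg[OF _ sup_rayleigh_bdd_above sup_rayleigh_nonneg])

lemma sup_eigenvalue_le:
  assumes "1 \<le> k" "A \<in> punctured_family B k" "\<And>f. f \<in> A \<Longrightarrow> sup_rayleigh E w f \<le> t"
  shows "sup_eigenvalue E w B k \<le> t"
proof -
  have ne: "A' \<noteq> {}" if "A' \<in> punctured_family B k" for A'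
    by (rule punctured_family_nonempty[OF that assms(1)])
  have "sup_eigenvalue E w B k \<le> (SUP f\<in>A. sup_rayleigh E w f)"
    unfolding sup_eigenvalue_def
    by (rule cINF_lower[OF bdd_belowI2[of _ 0] assms(2)]) (use SUP_sup_rayleigh_nonneg ne in blast)
  also have "\<dots> \<le> t" by (rule cSUP_least[OF ne[OF assms(2)] assms(3)])
  finally show ?thesis .
qed

lemma sup_eigenvalue_nonneg:
  assumes "1 \<le> k" "punctured_family B k \<noteq> {}" shows "0 \<le> sup_eigenvalue E w B k"
  unfolding sup_eigenvalue_def
  by (rule cINF_greatest[OF assms(2)])
    (rule SUP_sup_rayleigh_nonneg[OF punctured_family_nonempty[OF _ assms(1)]])

text \<open>
  The sets in \<open>genus_family k (psphere B p)\<close> also belong to \<open>punctured_family B k\<close>, which gives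
  the lower bound. For the upper bound, any set of the larger family is projected to the
  \<open>p\<close>-sphere.
\<close>

lemma variational_eigenvalue_bounds:
  fixes E :: "('v::finite \<times> 'v) set"
  assumes k: "1 \<le> k" and ne: "punctured_family B k \<noteq> {}" and p: "0 < p"
  shows "variational_eigenvalue E w B k p powr (1/p) \<le>
      (real (card E) + 1) powr (1/p) * sup_eigenvalue E w B k" (is ?up)
    and "(1 / (2 * real CARD('v))) powr (1/p) * sup_eigenvalue E w B k \<le>
      variational_eigenvalue E w B k p powr (1/p)" (is ?low)
proof -
  let ?C = "real (card E) + 1" and ?c = "1 / (2 * real CARD('v))"
  let ?\<Lambda> = "sup_eigenvalue E w B k"
  let ?F = "genus_family k (psphere B p)"
  let ?\<rho> = "\<lambda>f. rayleigh E w p f powr p" and ?Q = "sup_rayleigh E w"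
  let ?v = "variational_eigenvalue E w B k p"
  have C: "0 < ?C" and c: "0 < ?c" by (auto simp: add_nonneg_pos)
  have \<Lambda>: "0 \<le> ?\<Lambda>" by (rule sup_eigenvalue_nonneg[OF k ne])
  have A_ne: "A \<noteq> {}" if "A \<in> ?F" for A
    using that nonempty_if_genus[OF _ k] by (auto simp: genus_family_def)
  have nz: "f \<noteq> 0" if "A \<in> ?F" "f \<in> A" for A f
    using genus_family_punctured[OF p that(1)] that(2) by (auto simp: punctured_family_def)
  obtain A0 where A0: "A0 \<in> ?F" using ne radial_projection[OF p] by blast
  obtain K where K: "\<And>f. ?Q f \<le> K" using sup_rayleigh_bounded[of E w] by blast
  have bdd: "bdd_above (?\<rho> ` A)" if A: "A \<in> ?F" for A
  proof (rule bdd_aboveI2)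
    fix f assume "f \<in> A"
    have "?\<rho> f \<le> ?C * ?Q f powr p" by (rule rayleigh_powr_bounds(1)[OF p nz[OF A \<open>f \<in> A\<close>]])
    also have "\<dots> \<le> ?C * K powr p"
      using C K[of f] p sup_rayleigh_nonneg[of E w f] by (intro mult_left_mono powr_mono2) auto
    finally show "?\<rho> f \<le> ?C * K powr p" .
  qed
  have sup_nn: "0 \<le> (SUP f\<in>A. ?\<rho> f)" if A: "A \<in> ?F" for A
    by (rule SUP_nonneg[OF A_ne[OF A] bdd[OF A]]) simp
  have v_def: "?v = (INF A\<in>?F. SUP f\<in>A. ?\<rho> f)" by (simp add: variational_eigenvalue_def)
  have v_nn: "0 \<le> ?v"
    unfolding v_def by (rule cINF_greatest) (use A0 sup_nn in auto)
  have "?c * ?\<Lambda> powr p \<le> (SUP f\<in>A. ?\<rho> f)" if A: "A \<in> ?F" for A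
  proof -
    let ?s = "SUP f\<in>A. ?\<rho> f"
    have "?\<Lambda> \<le> (?s / ?c) powr (1/p)"
    proof (rule sup_eigenvalue_le[OF k genus_family_punctured[OF p A]])
      fix f assume f: "f \<in> A"
      have "?c * ?Q f powr p \<le> ?\<rho> f" by (rule rayleigh_powr_bounds(2)[OF p nz[OF A f]])
      also have "\<dots> \<le> ?s" by (rule cSUP_upper[OF f bdd[OF A]])
      finally have "?Q f powr p \<le> ?s / ?c" using c by (simp add: field_simps)
      then have "(?Q f powr p) powr (1/p) \<le> (?s / ?c) powr (1/p)"
        using p by (intro powr_mono2) auto
      then show "?Q f \<le> (?s / ?c) powr (1/p)"
        using p sup_rayleigh_nonneg[of E w f] by (simp add: powr_powr)
    qed
    then have "?\<Lambda> powr p \<le> ((?s / ?c) powr (1/p)) powr p"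
      using \<Lambda> p by (intro powr_mono2) auto
    also have "\<dots> = ?s / ?c"
      using p sup_nn[OF A] c by (simp add: powr_powr)
    finally show ?thesis using c by (simp add: field_simps)
  qed
  then have "?c * ?\<Lambda> powr p \<le> ?v"
    unfolding v_def using A0 by (intro cINF_greatest) auto
  then have "(?c * ?\<Lambda> powr p) powr (1/p) \<le> ?v powr (1/p)"
    using p c by (intro powr_mono2) auto
  moreover have "(?c * ?\<Lambda> powr p) powr (1/p) = ?c powr (1/p) * ?\<Lambda>"
  proof -
    have "(?c * ?\<Lambda> powr p) powr (1/p) = ?c powr (1/p) * (?\<Lambda> powr p) powr (1/p)"
      by (rule powr_mult)
    also have "(?\<Lambda> powr p) powr (1/p) = ?\<Lambda>" using p \<Lambda> by (simp add: powr_powr)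
    finally show ?thesis .
  qed
  ultimately show ?low by (simp only:)
  have "(?v / ?C) powr (1/p) \<le> ?\<Lambda>"
    unfolding sup_eigenvalue_def
  proof (rule cINF_greatest[OF ne])
    fix A assume "A \<in> punctured_family B k"
    from radial_projection[OF p this, of E w] obtain A' where A': "A' \<in> ?F" "?Q ` A' = ?Q ` A" by blast
    let ?t = "SUP f\<in>A'. ?Q f"
    have t: "0 \<le> ?t" by (rule SUP_sup_rayleigh_nonneg[OF A_ne[OF A'(1)]])
    have "?v \<le> (SUP f\<in>A'. ?\<rho> f)"
      unfolding v_def by (rule cINF_lower[OF bdd_belowI2[of _ 0] A'(1)]) (rule sup_nn)
    also have "\<dots> \<le> ?C * ?t powr p"
    proof (rule cSUP_least[OF A_ne[OF A'(1)]])
      fix f assume f: "f \<in> A'"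
      have "?\<rho> f \<le> ?C * ?Q f powr p" by (rule rayleigh_powr_bounds(1)[OF p nz[OF A'(1) f]])
      also have "\<dots> \<le> ?C * ?t powr p"
        using C p sup_rayleigh_nonneg[of E w f] cSUP_upper[OF f sup_rayleigh_bdd_above, of E w]
        by (intro mult_left_mono powr_mono2) auto
      finally show "?\<rho> f \<le> ?C * ?t powr p" .
    qed
    finally have "?v / ?C \<le> ?t powr p" using C by (simp add: field_simps)
    then have "(?v / ?C) powr (1/p) \<le> (?t powr p) powr (1/p)"
      using p v_nn C by (intro powr_mono2) auto
    also have "\<dots> = ?t" using p t by (simp add: powr_powr)
    finally show "(?v / ?C) powr (1/p) \<le> (SUP f\<in>A. ?Q f)" using A'(2) by simp
  qed
  then show ?up
    using C v_nn by (simp add: powr_divide field_simps)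
qed

lemma variational_eigenvalue_tendsto:
  fixes E :: "('v::finite \<times> 'v) set"
  assumes "1 \<le> k" "punctured_family B k \<noteq> {}"
  shows "((\<lambda>p. variational_eigenvalue E w B k p powr (1/p)) \<longlongrightarrow> sup_eigenvalue E w B k) at_top"
proof -
  have lim: "((\<lambda>p. c powr (1/p) * t) \<longlongrightarrow> t) at_top" if "0 < c" for c t :: real
  proof -
    have "((\<lambda>p::real. 1/p) \<longlongrightarrow> 0) at_top"
      by (rule tendsto_divide_0[OF tendsto_const filterlim_at_top_imp_at_infinity[OF filterlim_ident]])
    then have "((\<lambda>p. c powr (1/p) * t) \<longlongrightarrow> c powr 0 * t) at_top"
      using that by (intro tendsto_intros) auto
    then show ?thesis using that by simp
  qed
  have ev: "\<forall>\<^sub>F p::real in at_top. 0 < p" by (rule eventually_gt_at_top)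
  show ?thesis
  proof (rule tendsto_sandwich)
    show "((\<lambda>p. (1 / (2 * real CARD('v))) powr (1/p) * sup_eigenvalue E w B k) \<longlongrightarrow>
        sup_eigenvalue E w B k) at_top"
      by (rule lim) simp
    show "((\<lambda>p. (real (card E) + 1) powr (1/p) * sup_eigenvalue E w B k) \<longlongrightarrow>
        sup_eigenvalue E w B k) at_top"
      by (rule lim) (simp add: add_nonneg_pos)
    show "\<forall>\<^sub>F p in at_top. (1 / (2 * real CARD('v))) powr (1/p) * sup_eigenvalue E w B k \<le>
        variational_eigenvalue E w B k p powr (1/p)"
      using ev by (rule eventually_mono) (rule variational_eigenvalue_bounds(2)[OF assms])
    show "\<forall>\<^sub>F p in at_top. variational_eigenvalue E w B k p powr (1/p) \<le>
        (real (card E) + 1) powr (1/p) * sup_eigenvalue E w B k"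
      using ev by (rule eventually_mono) (rule variational_eigenvalue_bounds(1)[OF assms])
  qed
qed

section \<open>Packing radii bound the limit\<close>

text \<open>
  The combinations of the tents at the centres of a packing, with coefficients on the boundary of
  the cube, are an admissible set in the min-max.
\<close>

lemma sup_eigenvalue_le_packing:
  fixes E :: "('v::finite \<times> 'v) set"
  assumes G: "weighted_graph_with_boundary E w B" and k: "1 \<le> k" and r: "r \<in> packing_set E w B k"
  shows "punctured_family B k \<noteq> {}" "sup_eigenvalue E w B k \<le> 1 / r"
proof -
  interpret weighted_graph_with_boundary E w B by (rule G)
  obtain u where r0: "0 < r"
    and far: "\<And>i j. i \<in> {1..k} \<Longrightarrow> j \<in> {1..k} \<Longrightarrow> i \<noteq> j \<Longrightarrow> ereal (2 * r) \<le> graph_dist E w (u i) (u j)"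
    and bd: "\<And>i. i \<in> {1..k} \<Longrightarrow> ereal r \<le> boundary_dist E w B (u i)"
    using r unfolding packing_set_def mem_Collect_eq Compl_iff by blast
  define U where "U = u ` {1..k}"
  \<comment> \<open>The condition on the centres already makes them distinct.\<close>
  have inj: "inj_on u {1..k}"
  proof (rule inj_onI, rule ccontr)
    fix i j assume ij: "i \<in> {1..k}" "j \<in> {1..k}" "u i = u j" "i \<noteq> j"
    have "graph_dist E w (u i) (u i) < ereal (2 * r)"
      unfolding graph_dist_less_iff using walk.nil[of E w "u i"] r0 by (intro exI[of _ 0]) simp
    then show False using far[OF ij(1,2,4)] ij(3) by simp
  qed
  have cU: "card U = k" unfolding U_def using card_image[OF inj] by simp
  have U: "U \<noteq> {}" using k by (auto simp: U_def)
  have farU: "ereal (2 * r) \<le> graph_dist E w c c'" if "c \<in> U" "c' \<in> U" "c \<noteq> c'" for c c'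
    using that far unfolding U_def by blast
  let ?T = "tent_combination E w r U"
  define A where "A = ?T ` coord_sphere U"
  have sphere: "\<And>c. \<bar>a $ c\<bar> \<le> 1" "\<exists>c\<in>U. \<bar>a $ c\<bar> = 1" if "a \<in> coord_sphere U" for a
    using that by (auto simp: coord_sphere_def)
  have centre: "?T a $ c = r * a $ c" if "a \<in> coord_sphere U" "c \<in> U" for a c
    by (rule tent_combination_bounds(1)[OF r0 U]) (use farU sphere(1) that in auto)
  have slope: "\<bar>gradient w (?T a) v x\<bar> \<le> 1" if "a \<in> coord_sphere U" "(v, x) \<in> E" for a v x
    by (rule tent_combination_bounds(2)[OF r0 U]) (use farU sphere(1) that in auto)
  have large: "\<exists>c. \<bar>?T a $ c\<bar> = r" if "a \<in> coord_sphere U" for a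
  proof -
    obtain c where c: "c \<in> U" "\<bar>a $ c\<bar> = 1" using sphere(2)[OF \<open>a \<in> coord_sphere U\<close>] by blast
    then have "\<bar>?T a $ c\<bar> = r"
      using centre[OF \<open>a \<in> coord_sphere U\<close> c(1)] r0 by (simp add: abs_mult)
    then show ?thesis by blast
  qed
  have lin: "linear ?T"
    by (rule linearI)
      (simp_all add: tent_combination_def vec_eq_iff distrib_right sum.distrib sum_distrib_left mult.assoc)
  have cont: "continuous_on S ?T" for S
    by (rule linear_continuous_on) (simp add: lin linear_conv_bounded_linear[symmetric])
  have neg: "?T (- a) = - ?T a" for a by (rule linear_neg[OF lin])
  have A: "A \<in> punctured_family B k"
    unfolding punctured_family_def mem_Collect_eq
  proof (intro conjI)
    show "A \<subseteq> H0 B - {0}"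
    proof
      fix f assume "f \<in> A"
      then obtain a where a: "a \<in> coord_sphere U" "f = ?T a" by (auto simp: A_def)
      have "f $ x = 0" if "x \<in> B" for x
      proof -
        have "tent E w r c x = 0" if "c \<in> U" for c
        proof (rule tent_eq_0[OF r0])
          obtain i where i: "i \<in> {1..k}" "c = u i" using \<open>c \<in> U\<close> by (auto simp: U_def)
          have "boundary_dist E w B c \<le> graph_dist E w c x"
            unfolding boundary_dist_def by (rule INF_lower[OF \<open>x \<in> B\<close>])
          then show "ereal r \<le> graph_dist E w c x" using bd[OF i(1)] i(2) by (metis order_trans)
        qed
        then show ?thesis by (simp add: a(2) tent_combination_def)
      qed
      moreover have "f \<noteq> 0" using large[OF a(1)] r0 a(2) by auto
      ultimately show "f \<in> H0 B - {0}" by (simp add: H0_def)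
    qed
    show "compact A" unfolding A_def by (rule compact_continuous_image[OF cont compact_coord_sphere])
    have "uminus ` coord_sphere U = coord_sphere U"
    proof
      show "uminus ` coord_sphere U \<subseteq> coord_sphere U" using uminus_coord_sphere by blast
      show "coord_sphere U \<subseteq> uminus ` coord_sphere U"
        using uminus_coord_sphere by (metis image_eqI minus_minus subsetI)
    qed
    moreover have "uminus ` A = ?T ` uminus ` coord_sphere U" by (simp add: A_def image_image neg)
    ultimately show "uminus ` A = A" by (simp add: A_def)
    have "genus (coord_sphere U) \<le> genus A"
      by (rule genus_mono_odd_map[OF cont]) (auto simp: A_def neg)
    then show "enat k \<le> genus A" using genus_coord_sphere[of U] cU by (simp add: order_trans)
  qed
  then show "punctured_family B k \<noteq> {}" by blast
  show "sup_eigenvalue E w B k \<le> 1 / r"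
  proof (rule sup_eigenvalue_le[OF k A])
    fix f assume "f \<in> A"
    then obtain a where a: "a \<in> coord_sphere U" "f = ?T a" by (auto simp: A_def)
    have "sup_gradient E w f \<le> 1"
      by (rule sup_gradient_leI) (use slope[OF a(1)] a(2) in auto)
    moreover have "r \<le> sup_norm f" using large[OF a(1)] sup_norm_upper[of f] a(2) by metis
    ultimately show "sup_rayleigh E w f \<le> 1 / r"
      unfolding sup_rayleigh_def using r0 by (intro frac_le) auto
  qed
qed

theorem proposition3p9:
  fixes E :: "('v::finite \<times> 'v) set"
    and w :: "'v \<Rightarrow> 'v \<Rightarrow> real"
    and B :: "'v set"
    and k :: nat
  assumes "weighted_graph_with_boundary E w B"
    and "1 \<le> k" and "k \<le> card (- B)"
  shows "((\<lambda>p. variational_eigenvalue E w B k p powr (1/p)) \<longlongrightarrow> limit_eigenvalue E w B k) at_top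
         \<and> ereal (limit_eigenvalue E w B k) \<le> 1 / packing_radius E w B k"
proof -
  let ?\<Lambda> = "sup_eigenvalue E w B k" and ?R = "packing_radius E w B k"
  obtain r where r: "r \<in> packing_set E w B k"
    using weighted_graph_with_boundary.packing_set_nonempty[OF assms(1,3)] by blast
  note le = sup_eigenvalue_le_packing[OF assms(1,2)]
  have tendsto: "((\<lambda>p. variational_eigenvalue E w B k p powr (1/p)) \<longlongrightarrow> ?\<Lambda>) at_top"
    by (rule variational_eigenvalue_tendsto[OF assms(2) le(1)[OF r]])
  have limit: "limit_eigenvalue E w B k = ?\<Lambda>"
    unfolding limit_eigenvalue_def by (rule tendsto_Lim[OF _ tendsto]) simp
  have "0 < r" using r by (simp add: packing_set_def)
  have "ereal r \<le> ?R" unfolding packing_radius_def by (rule SUP_upper[OF r])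
  then have R: "0 < ?R" using \<open>0 < r\<close> by (cases ?R) auto
  have "ereal ?\<Lambda> \<le> 1 / ?R"
  \<comment> \<open>If the limit is 0, its inverse is no bound for the radii, which may then be unbounded.\<close>
  proof (cases "?\<Lambda> \<le> 0")
    case True
    then have "ereal ?\<Lambda> \<le> 0" by simp
    also have "0 \<le> 1 / ?R" using R by (cases ?R) auto
    finally show ?thesis .
  next
    case False
    have "?R \<le> ereal (1 / ?\<Lambda>)"
      unfolding packing_radius_def
    proof (rule SUP_least)
      fix s assume s: "s \<in> packing_set E w B k"
      then have "0 < s" by (simp add: packing_set_def)
      then show "ereal s \<le> ereal (1 / ?\<Lambda>)" using le(2)[OF s] False by (simp add: field_simps)
    qed
    then show ?thesis using R False by (cases ?R) (auto simp: field_simps one_ereal_def)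
  qed
  then show ?thesis using tendsto limit by simp
qed

end
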